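(* Consider the hybrid mechanical system described in the context, whose event at time $t_{\rm eve}=t_{\rm eve}(\rho)$ consists only of a sudden change of the equations of motion: the generalized acceleration right before and right after the event is $$\ddot q|_{t_{\rm eve}}^{-}=f^{\rm eom-}\big(t_{\rm eve},q|_{t_{\rm eve}},v|_{t_{\rm eve}},\rho\big)=:f^{\rm eom-}|_{t_{\rm eve}},\qquad \ddot q|_{t_{\rm eve}}^{+}=f^{\rm eom+}\big(t_{\rm eve},q|_{t_{\rm eve}},v|_{t_{\rm eve}},\rho\big)=:f^{\rm eom+}|_{t_{\rm eve}},$$ and there is no jump in the velocity, $v|_{t_{\rm eve}}^{+}=v|_{t_{\rm eve}}^{-}$ (the velocity jump function is the identity). Let $V|_{t_{\rm eve}}^{+},V|_{t_{\rm eve}}^{-}\in\mathbb{R}^{n\times p}$ be the sensitivities of the generalized velocity with respect to the parameters right after and right before the event. Then $$V|_{t_{\rm eve}}^{+}=V|_{t_{\rm eve}}^{-}-\left(\ddot q|_{t_{\rm eve}}^{+}-\ddot q|_{t_{\rm eve}}^{-}\right)\cdot\frac{dt_{\rm eve}}{d\rho}=V|_{t_{\rm eve}}^{-}-\left(f^{\rm eom+}|_{t_{\rm eve}}-f^{\rm eom-}|_{t_{\rm eve}}\right)\cdot\frac{dt_{\rm eve}}{d\rho}.$$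
   Context: System. $q\in\mathbb{R}^n$ is the generalized position, $v=\dot q\in\mathbb{R}^n$ the generalized velocity, $\rho\in\mathbb{R}^p$ the parameter vector. The dynamics are $\dot q=v$, $\dot v=f(t,q,v,\rho)$ for $t_0\le t\le t_F$, with initial conditions $q(t_0)=q_0(\rho)$, $v(t_0)=v_0(\rho)$ depending differentiably on $\rho$. Here $f=f^{\rm eom-}$ before the event and $f=f^{\rm eom+}$ after the event. Each function $f^{\rm eom\pm}$ has the form $\mathsf{M}^{-1}(t,q,\rho)\,\mathsf{F}(t,q,v,\rho)$, with $\mathsf{M}$ an invertible $n\times n$ mass matrix and $\mathsf{F}$ an $\mathbb{R}^n$-valued force; $\mathsf M$, $\mathsf M^{-1}$ and $\mathsf F$ are smooth in all arguments. The solution is written $q(t,\rho)$, $v(t,\rho)$. Event. There are finitely many events along the trajectory (no Zeno behavior); the result concerns one of them, isolated in time. The event time $t_{\rm eve}(\rho)$ is determined by $r\big(q(t_{\rm eve}(\rho),\rho)\big)=0$, where $r:\mathbb{R}^n\to\mathbb{R}$ is a smooth event function. There is no grazing: the trajectory does not touch the event surface tangentially, i.e. $\frac{dr}{dq}(q|_{t_{\rm eve}})\cdot v|_{t_{\rm eve}}^{-}\neq 0$. The row vector $\frac{dt_{\rm eve}}{d\rho}\in\mathbb{R}^{1\times p}$ is the derivative of $t_{\rm eve}(\rho)$. One-sided values. For any quantity $x$, $x|_{t_{\rm eve}}^{-}=\lim_{\varepsilon\downarrow 0}x(t_{\rm eve}-\varepsilon)$ and $x|_{t_{\rm eve}}^{+}=\lim_{\varepsilon\downarrow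 0}x(t_{\rm eve}+\varepsilon)$; the evolution is smooth in time on each side of the event. When the two values agree they are denoted $x|_{t_{\rm eve}}$. Positions do not jump: $q|_{t_{\rm eve}}^{+}=q|_{t_{\rm eve}}^{-}=q|_{t_{\rm eve}}$. Sensitivities. $V(t,\rho)=\frac{dv}{d\rho}(t,\rho)\in\mathbb{R}^{n\times p}$ is the derivative at fixed $t$, and $V|^{\pm}_{t_{\rm eve}}$ are its one-sided limits in $t$ at the event. *)

theory Defs
  imports "HOL-Analysis.Analysis"
begin

primrec C_k_on :: "nat \<Rightarrow> ('a::real_normed_vector \<Rightarrow> 'b::real_normed_vector) \<Rightarrow> 'a set \<Rightarrow> bool" where
  "C_k_on 0 f S \<longleftrightarrow> continuous_on S f"
| "C_k_on (Suc k) f S \<longleftrightarrow>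
     f differentiable_on S \<and> (\<forall>h. C_k_on k (\<lambda>x. frechet_derivative f (at x) h) S)"

(* Only meant for open S, where "differentiable_on S" and "at x" agree.  On finite-dimensional
   domains, continuity of all iterated directional derivatives is the usual notion. *)
definition smooth_on :: "('a::real_normed_vector \<Rightarrow> 'b::real_normed_vector) \<Rightarrow> 'a set \<Rightarrow> bool" where
  "smooth_on f S \<longleftrightarrow> (\<forall>k. C_k_on k f S)"

type_synonym ('n, 'p) mass = "real \<Rightarrow> real^'n \<Rightarrow> real^'p \<Rightarrow> real^'n^'n"
type_synonym ('n, 'p) force = "real \<Rightarrow> real^'n \<Rightarrow> real^'n \<Rightarrow> real^'p \<Rightarrow> real^'n"

definition eom :: "('n::finite, 'p::finite) mass \<Rightarrow> ('n, 'p) force \<Rightarrow> ('n, 'p) force" where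
  "eom M F t q v \<rho> = matrix_inv (M t q \<rho>) *v F t q v \<rho>"

definition regular_eom ::
  "real set \<Rightarrow> (real^'p) set \<Rightarrow> ('n::finite, 'p::finite) mass \<Rightarrow> ('n, 'p) force \<Rightarrow> bool" where
  "regular_eom T P M F \<longleftrightarrow>
     (\<forall>t\<in>T. \<forall>q. \<forall>\<rho>\<in>P. invertible (M t q \<rho>)) \<and>
     smooth_on (\<lambda>(t, q, \<rho>). M t q \<rho>) (T \<times> UNIV \<times> P) \<and>
     smooth_on (\<lambda>(t, q, \<rho>). matrix_inv (M t q \<rho>)) (T \<times> UNIV \<times> P) \<and>
     smooth_on (\<lambda>(t, q, v, \<rho>). F t q v \<rho>) (T \<times> UNIV \<times> UNIV \<times> P)"

(* A family of trajectories on [t0, tF], indexed by parameters in the open set P, with N events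
   at the times \<tau> 1 \<rho> < ... < \<tau> N \<rho>; \<tau> 0 and \<tau> (N + 1) are the constants t0 and tF.  On the
   phase between \<tau> k \<rho> and \<tau> (k + 1) \<rho> the equations of motion are given by M k and F k.
   At events the velocity may jump (in this locale) but the position may not.  The values
   v (\<tau> k \<rho>) \<rho> at event times carry no information; only one-sided limits are used there.
   Continuity of all \<tau> k keeps each event isolated uniformly for nearby parameters. *)
locale hybrid_system =
  fixes t0 tF :: real
    and P :: "(real^'p::finite) set"
    and N :: nat
    and M :: "nat \<Rightarrow> ('n::finite, 'p) mass"
    and F :: "nat \<Rightarrow> ('n, 'p) force"
    and q0 v0 :: "real^'p \<Rightarrow> real^'n"
    and \<tau> :: "nat \<Rightarrow> real^'p \<Rightarrow> real"
    and q v :: "real \<Rightarrow> real^'p \<Rightarrow> real^'n"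
  assumes open_parameters: "open P"
    and regular: "\<And>k. k \<le> N \<Longrightarrow> regular_eom {t0<..<tF} P (M k) (F k)"
    and initial_differentiable: "q0 differentiable_on P" "v0 differentiable_on P"
    and first_time: "\<And>\<rho>. \<rho> \<in> P \<Longrightarrow> \<tau> 0 \<rho> = t0"
    and last_time: "\<And>\<rho>. \<rho> \<in> P \<Longrightarrow> \<tau> (Suc N) \<rho> = tF"
    and times_increasing: "\<And>k \<rho>. k \<le> N \<Longrightarrow> \<rho> \<in> P \<Longrightarrow> \<tau> k \<rho> < \<tau> (Suc k) \<rho>"
    and times_continuous: "\<And>k. k \<le> Suc N \<Longrightarrow> continuous_on P (\<tau> k)"
    and initial_position: "\<And>\<rho>. \<rho> \<in> P \<Longrightarrow> q t0 \<rho> = q0 \<rho>"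
    and initial_velocity: "\<And>\<rho>. \<rho> \<in> P \<Longrightarrow> v t0 \<rho> = v0 \<rho>"
    and initial_velocity_limit: "\<And>\<rho>. \<rho> \<in> P \<Longrightarrow> ((\<lambda>t. v t \<rho>) \<longlongrightarrow> v0 \<rho>) (at_right t0)"
    and position_continuous: "\<And>\<rho>. \<rho> \<in> P \<Longrightarrow> continuous_on {t0..tF} (\<lambda>t. q t \<rho>)"
    and position_ode: "\<And>k t \<rho>. k \<le> N \<Longrightarrow> \<rho> \<in> P \<Longrightarrow> t \<in> {\<tau> k \<rho><..<\<tau> (Suc k) \<rho>} \<Longrightarrow>
          ((\<lambda>s. q s \<rho>) has_vector_derivative v t \<rho>) (at t)"
    and velocity_ode: "\<And>k t \<rho>. k \<le> N \<Longrightarrow> \<rho> \<in> P \<Longrightarrow> t \<in> {\<tau> k \<rho><..<\<tau> (Suc k) \<rho>} \<Longrightarrow>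
          ((\<lambda>s. v s \<rho>) has_vector_derivative eom (M k) (F k) t (q t \<rho>) (v t \<rho>) \<rho>) (at t)"
    and velocity_limits: "\<And>k \<rho>. k \<in> {1..N} \<Longrightarrow> \<rho> \<in> P \<Longrightarrow>
          (\<exists>l. ((\<lambda>t. v t \<rho>) \<longlongrightarrow> l) (at_left (\<tau> k \<rho>))) \<and>
          (\<exists>l. ((\<lambda>t. v t \<rho>) \<longlongrightarrow> l) (at_right (\<tau> k \<rho>)))"

definition acceleration :: "(real \<Rightarrow> real^'p::finite \<Rightarrow> real^'n::finite) \<Rightarrow> real^'p \<Rightarrow> real \<Rightarrow> real^'n" where
  "acceleration q \<rho> t =
     vector_derivative (\<lambda>s. vector_derivative (\<lambda>u. q u \<rho>) (at s)) (at t)"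

definition velocity_sensitivity ::
  "(real \<Rightarrow> real^'p::finite \<Rightarrow> real^'n::finite) \<Rightarrow> real^'p \<Rightarrow> real \<Rightarrow> real^'p^'n" where
  "velocity_sensitivity v \<rho> t = jacobian (v t) (at \<rho>)"

(* 1 x p row vector *)
definition time_sensitivity :: "(real^'p::finite \<Rightarrow> real) \<Rightarrow> real^'p \<Rightarrow> real^'p^1" where
  "time_sensitivity t_eve \<rho> = jacobian (\<lambda>\<rho>'. vec (t_eve \<rho>') :: real^1) (at \<rho>)"

end

theory Submission
  imports Defs
begin

text \<open>Compare the trajectories for \<open>p\<close> and \<open>\<rho>\<close> between fixed times \<open>t1 < T < t2\<close> around the event.
  While both are in the same phase, the difference of velocities grows at rate \<open>O(|p - \<rho>|)\<close>;
  between the two event times it grows at rate \<open>\<plusminus>(f_minus - f_plus) + O(|p - \<rho>|)\<close>. Hence its increment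
  over \<open>[t1, t2]\<close> is \<open>(t_eve p - t_eve \<rho>) (f_minus - f_plus) + O((t2 - t1) |p - \<rho>|)\<close>.
  Differentiating in \<open>p\<close> and letting \<open>t1\<close> and \<open>t2\<close> tend to \<open>T\<close> gives the jump of the sensitivity.\<close>

text \<open>Differentiating \<open>v (t_eve p) p\<close> by the chain rule from either side would
  need differentiability jointly in \<open>(t, p)\<close> up to the moving event. The hypotheses
  give derivatives at \<open>\<rho>\<close> only for fixed \<open>t\<close> near the event, and
  limits of these in \<open>t\<close>; hence the fixed comparison times. What matters is the order
  of quantifiers: the constant in the error term is the same for all \<open>t1\<close>,
  \<open>t2\<close>, while the neighbourhood of \<open>\<rho>\<close> may shrink with them.
  Differentiation at \<open>\<rho>\<close> does not see the size of the neighbourhood, so the factor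
  \<open>t2 - t1\<close> survives and removes the error in the limit. The force depends on position
  as well, so the estimate is made for the pair of position and velocity. Closeness of order
  \<open>|p - \<rho>|\<close> is fed in at one time before the event, where differentiability in the
  parameter is assumed, and is carried across the event by the differential equation, whose
  regularity enters as a local Lipschitz bound.\<close>

section \<open>Local Lipschitz bounds\<close>

lemma C_1_on_imp_locally_lipschitz:
  fixes f :: "'a::euclidean_space \<Rightarrow> 'b::real_normed_vector"
  assumes "C_k_on (Suc 0) f S" "open S" "z \<in> S"
  obtains e L where "e > 0" "L-lipschitz_on (cball z e) f"
proof -
  define f' where "f' x = frechet_derivative f (at x)" for x
  \<comment> \<open>\<open>B x\<close> dominates the operator norm of the derivative, and its
    continuity follows directly from that of the directional derivatives, which is what
    \<open>C_k_on\<close> provides.\<close>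
  define B where "B x = (\<Sum>i\<in>Basis. norm (f' x i))" for x
  have deriv: "(f has_derivative f' x) (at x)" if "x \<in> S" for x
    using assms that unfolding f'_def
    by (simp add: differentiable_on_eq_differentiable_at flip: frechet_derivative_works)
  have "continuous_on S B"
    using assms unfolding B_def f'_def by (intro continuous_intros) auto
  moreover obtain e where e: "e > 0" "cball z e \<subseteq> S"
    using assms open_contains_cball by blast
  ultimately have "compact (B ` cball z e)"
    by (intro compact_continuous_image compact_cball) (rule continuous_on_subset)
  then obtain L where "\<forall>y\<in>B ` cball z e. norm y \<le> L"
    using compact_imp_bounded[THEN bounded_iff[THEN iffD1]] by blast
  then have L: "norm (B x) \<le> L" if "x \<in> cball z e" for x
    using that by blast
  have "L-lipschitz_on (cball z e) f"
  proof (rule lipschitz_onI)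
    have "norm (B z) \<le> L"
      using e by (intro L) simp
    then show "0 \<le> L"
      by (rule order_trans[OF norm_ge_zero])
    fix x y assume xy: "x \<in> cball z e" "y \<in> cball z e"
    show "dist (f x) (f y) \<le> L * dist x y"
      unfolding dist_norm
    proof (rule differentiable_bound[OF convex_cball _ _ xy])
      fix x assume x: "x \<in> cball z e"
      have f': "(f has_derivative f' x) (at x)"
        using x e by (intro deriv) blast
      then show "(f has_derivative f' x) (at x within cball z e)"
        by (rule has_derivative_at_withinI)
      have "onorm (f' x) \<le> B x"
        unfolding B_def using f' by (intro onorm_componentwise has_derivative_bounded_linear)
      then show "onorm (f' x) \<le> L"
        using L[OF x] by simp
    qed
  qed
  with e(1) show thesis by (rule that)
qed

text \<open>A product of Lipschitz maps is Lipschitz where both factors are bounded. On a ball such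
  bounds, \<open>A\<close> and \<open>D\<close> below, come from the value at the centre and the
  radius.\<close>

lemma (in bounded_bilinear) lipschitz_on_cball_prod:
  fixes z :: "'d::real_normed_vector"
  assumes f: "L-lipschitz_on (cball z e) f" and g: "K-lipschitz_on (cball z e) g"
  obtains C where "C-lipschitz_on (cball z e) (\<lambda>x. prod (f x) (g x))"
proof (cases "e \<ge> 0")
  case True
  obtain b where b: "b \<ge> 0" "\<And>x y. norm (prod x y) \<le> norm x * norm y * b"
    using nonneg_bounded by blast
  note nn = lipschitz_on_nonneg[OF f] lipschitz_on_nonneg[OF g]
  define A where "A = norm (f z) + L * e"
  define D where "D = norm (g z) + K * e"
  have A: "norm (f x) \<le> A" if "x \<in> cball z e" for x
  proof -
    have "norm (f x - f z) \<le> L * norm (x - z)"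
      using lipschitz_on_normD[OF f] True that by simp
    also have "\<dots> \<le> L * e"
      using that nn by (intro mult_left_mono) (auto simp: dist_norm norm_minus_commute)
    finally show ?thesis
      unfolding A_def using norm_triangle_sub[of "f x" "f z"] by linarith
  qed
  have D: "norm (g x) \<le> D" if "x \<in> cball z e" for x
  proof -
    have "norm (g x - g z) \<le> K * norm (x - z)"
      using lipschitz_on_normD[OF g] True that by simp
    also have "\<dots> \<le> K * e"
      using that nn by (intro mult_left_mono) (auto simp: dist_norm norm_minus_commute)
    finally show ?thesis
      unfolding D_def using norm_triangle_sub[of "g x" "g z"] by linarith
  qed
  have nn': "A \<ge> 0" "D \<ge> 0"
    using nn True unfolding A_def D_def by simp_all
  have "(A * K * b + L * D * b)-lipschitz_on (cball z e) (\<lambda>x. prod (f x) (g x))"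
  proof (rule lipschitz_onI)
    show "0 \<le> A * K * b + L * D * b"
      using nn nn' b by simp
    fix x y assume xy: "x \<in> cball z e" "y \<in> cball z e"
    have "prod (f x) (g x) - prod (f y) (g y) = prod (f x) (g x - g y) + prod (f x - f y) (g y)"
      by (simp add: diff_left diff_right)
    then have "norm (prod (f x) (g x) - prod (f y) (g y))
        \<le> norm (f x) * norm (g x - g y) * b + norm (f x - f y) * norm (g y) * b"
      using b(2) norm_triangle_le by (metis add_mono)
    also have "\<dots> \<le> A * (K * norm (x - y)) * b + (L * norm (x - y)) * D * b"
      using A D xy lipschitz_on_normD[OF f] lipschitz_on_normD[OF g] nn nn' b(1)
      by (intro add_mono mult_mono) auto
    finally show "dist (prod (f x) (g x)) (prod (f y) (g y)) \<le> (A * K * b + L * D * b) * dist x y"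
      by (simp add: dist_norm algebra_simps)
  qed
  then show thesis by (rule that)
next
  case False
  then have "cball z e = {}" by simp
  then show thesis
    using that[of 0] by simp
qed

section \<open>Mean value estimates along curves\<close>

lemma increment_bound:
  fixes f :: "real \<Rightarrow> 'a::real_normed_vector"
  assumes "a \<le> b" "continuous_on {a..b} f"
    and "\<And>s. a < s \<Longrightarrow> s < b \<Longrightarrow> (f has_vector_derivative f' s) (at s)"
    and "\<And>s. a < s \<Longrightarrow> s < b \<Longrightarrow> norm (f' s) \<le> B"
  shows "norm (f b - f a) \<le> B * (b - a)"
proof (cases "a = b")
  case False
  have "norm (f b - f a) \<le> B * b - B * a"
    by (rule differentiable_bound_general[where f' = f' and \<phi>' = "\<lambda>_. B"])
      (use assms False in \<open>auto intro!: continuous_intros derivative_eq_intros\<close>)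
  then show ?thesis by (simp add: algebra_simps)
qed simp

text \<open>The weaker bound \<open>K\<close> is paid for only during the exceptional interval,
  which will be the gap between two event times. The degenerate case \<open>lo = hi\<close> covers a
  single instant without a derivative.\<close>

lemma increment_bound_exceptional_interval:
  fixes f :: "real \<Rightarrow> 'a::real_normed_vector"
  assumes "a \<le> b" "lo \<le> hi" "continuous_on {a..b} f" "B \<ge> 0" "K \<ge> 0"
    and deriv: "\<And>s. a < s \<Longrightarrow> s < b \<Longrightarrow> s \<noteq> lo \<Longrightarrow> s \<noteq> hi \<Longrightarrow>
          (f has_vector_derivative f' s) (at s)"
    and B: "\<And>s. a < s \<Longrightarrow> s < b \<Longrightarrow> s < lo \<or> hi < s \<Longrightarrow> norm (f' s) \<le> B"
    and K: "\<And>s. a < s \<Longrightarrow> s < b \<Longrightarrow> lo < s \<Longrightarrow> s < hi \<Longrightarrow> norm (f' s) \<le> K"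
  shows "norm (f b - f a) \<le> B * (b - a) + K * (hi - lo)"
proof -
  \<comment> \<open>Clamping to \<open>[a, b]\<close> covers every relative position of the two
    intervals: an exceptional interval outside \<open>[a, b]\<close> collapses to an
    endpoint.\<close>
  define c where "c = max a (min lo b)"
  define d where "d = max a (min hi b)"
  have ord: "a \<le> c" "c \<le> d" "d \<le> b" "d - c \<le> hi - lo"
    using assms(1,2) unfolding c_def d_def by auto
  have cont: "continuous_on {x..y} f" if "a \<le> x" "y \<le> b" for x y
    using assms(3) by (rule continuous_on_subset) (use that in auto)
  have "norm (f c - f a) \<le> B * (c - a)"
    by (rule increment_bound[where f' = f'])
      (use ord in \<open>auto intro!: cont deriv B simp: c_def\<close>)
  moreover have "norm (f d - f c) \<le> K * (d - c)"
    by (rule increment_bound[where f' = f'])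
      (use ord in \<open>auto intro!: cont deriv K simp: c_def d_def\<close>)
  moreover have "norm (f b - f d) \<le> B * (b - d)"
    by (rule increment_bound[where f' = f'])
      (use ord assms(2) in \<open>auto intro!: cont deriv B simp: d_def\<close>)
  moreover have "norm (f b - f a) \<le> norm (f c - f a) + norm (f d - f c) + norm (f b - f d)"
    using norm_triangle_ineq[of "f b - f d" "f d - f a"] norm_triangle_ineq[of "f d - f c" "f c - f a"]
    by simp
  moreover have "B * (c - a) + B * (b - d) \<le> B * (b - a)"
    using ord \<open>B \<ge> 0\<close> by (simp add: mult_left_mono flip: distrib_left)
  moreover have "K * (d - c) \<le> K * (hi - lo)"
    using ord \<open>K \<ge> 0\<close> by (intro mult_left_mono)
  ultimately show ?thesis by linarith
qed

text \<open>The speed bound is known only inside the ball. It therefore holds up to the first exit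
  time, and by then the curve has travelled at most \<open>K * (b - a)\<close>, too little to reach
  the boundary.\<close>

lemma stays_in_ball:
  fixes w :: "real \<Rightarrow> 'a::real_normed_vector"
  assumes cont: "continuous_on {a..b} w" and K: "K \<ge> 0"
    and deriv: "\<And>s. a < s \<Longrightarrow> s < b \<Longrightarrow> s \<noteq> c \<Longrightarrow> (w has_vector_derivative w' s) (at s)"
    and bound: "\<And>s. a < s \<Longrightarrow> s < b \<Longrightarrow> s \<noteq> c \<Longrightarrow> norm (w s - z) \<le> r \<Longrightarrow> norm (w' s) \<le> K"
    and start: "norm (w a - z) + K * (b - a) < r"
    and s: "s \<in> {a..b}"
  shows "norm (w s - z) < r"
proof (rule ccontr)
  assume out: "\<not> norm (w s - z) < r"
  \<comment> \<open>\<open>E\<close> is closed by continuity, so its infimum is attained and is the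
    first exit time.\<close>
  define E where "E = {a..b} \<inter> (\<lambda>s. norm (w s - z)) -` {r..}"
  have "closed E"
    unfolding E_def using cont by (intro continuous_closed_preimage continuous_intros) auto
  moreover have bdd: "bdd_below E"
    unfolding E_def by (intro bdd_belowI[of _ a]) auto
  moreover have "E \<noteq> {}"
    using out s unfolding E_def by auto
  ultimately have x: "Inf E \<in> E"
    using closed_contains_Inf by blast
  define x where "x = Inf E"
  have ab: "a \<le> x" "x \<le> b" and out_x: "norm (w x - z) \<ge> r"
    using x unfolding x_def E_def by auto
  have inside: "norm (w y - z) \<le> r" if "a \<le> y" "y < x" for y
  proof (rule ccontr)
    assume "\<not> ?thesis"
    then have "y \<in> E" using that ab unfolding E_def by auto
    then show False
      using cInf_lower[OF _ bdd] that unfolding x_def by force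
  qed
  have "norm (w x - w a) \<le> K * (x - a) + K * (c - c)"
    by (rule increment_bound_exceptional_interval[where f' = w'])
      (use ab K in \<open>auto intro!: deriv bound inside continuous_on_subset[OF cont]\<close>)
  moreover have "K * (x - a) \<le> K * (b - a)"
    using ab K by (intro mult_left_mono) auto
  moreover have "norm (w x - z) \<le> norm (w x - w a) + norm (w a - z)"
    using norm_triangle_ineq[of "w x - w a" "w a - z"] by simp
  ultimately show False
    using start out_x by simp
qed

section \<open>Linear growth bounds and derivatives\<close>

text \<open>Approach \<open>x\<close> along the ray in direction \<open>h\<close>: by linearity the
  step length cancels, leaving the bound for \<open>f' h\<close> up to the slack \<open>e\<close>
  from the definition of the derivative.\<close>

lemma has_derivative_norm_le:
  assumes "(f has_derivative f') (at x)"
    and "\<forall>\<^sub>F y in at x. norm (f y - f x) \<le> B * norm (y - x)"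
  shows "norm (f' h) \<le> B * norm h"
proof (cases "h = 0")
  case True
  then show ?thesis
    using has_derivative_bounded_linear[OF assms(1)] by (simp add: linear_simps)
next
  case False
  interpret f': bounded_linear f'
    by (rule has_derivative_bounded_linear[OF assms(1)])
  have *: "norm (f' h) \<le> (B + e) * norm h" if "e > 0" for e
  proof -
    have "\<forall>\<^sub>F y in at x. norm (f y - f x - f' (y - x)) \<le> e * norm (y - x)"
      using assms(1) that unfolding has_derivative_within_alt2 by simp
    with assms(2) have "\<forall>\<^sub>F y in at x. norm (f' (y - x)) \<le> (B + e) * norm (y - x)"
    proof eventually_elim
      case (elim y)
      then show ?case
        using norm_triangle_ineq4[of "f y - f x" "f y - f x - f' (y - x)"]
        by (simp add: algebra_simps)
    qed
    moreover have "filterlim (\<lambda>s. x + s *\<^sub>R h) (at x) (at_right 0)"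
    proof (rule filterlim_atI)
      show "((\<lambda>s. x + s *\<^sub>R h) \<longlongrightarrow> x) (at_right 0)"
        by (rule tendsto_eq_intros | simp)+
      show "\<forall>\<^sub>F s in at_right 0. x + s *\<^sub>R h \<noteq> x"
        using False by (simp add: eventually_at_filter)
    qed
    ultimately have "\<forall>\<^sub>F s in at_right 0. norm (f' (x + s *\<^sub>R h - x)) \<le> (B + e) * norm (x + s *\<^sub>R h - x)"
      by (rule eventually_compose_filterlim)
    then have "\<forall>\<^sub>F s::real in at_right 0. norm (f' h) \<le> (B + e) * norm h"
      using eventually_at_right_less
    proof eventually_elim
      case (elim s)
      then have "s * norm (f' h) \<le> s * ((B + e) * norm h)"
        by (simp add: f'.scaleR algebra_simps)
      then show ?case
        using elim by simp
    qed
    then show ?thesis by simp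
  qed
  \<comment> \<open>Taking \<open>e / norm h\<close> as slack turns the relative error into an
    absolute one.\<close>
  then have "norm (f' h) \<le> B * norm h + e" if "e > 0" for e
    using *[of "e / norm h"] that False by (simp add: distrib_right)
  then show ?thesis
    by (rule field_le_epsilon)
qed

lemma differentiable_imp_eventually_lipschitz:
  fixes f :: "'a::real_normed_vector \<Rightarrow> 'b::real_normed_vector"
  assumes "f differentiable (at x)"
  obtains C where "C \<ge> 0" "\<forall>\<^sub>F y in nhds x. norm (f y - f x) \<le> C * norm (y - x)"
proof -
  from assms obtain f' where f': "(f has_derivative f') (at x)"
    unfolding differentiable_def by blast
  note bl = has_derivative_bounded_linear[OF f']
  have "\<forall>\<^sub>F y in at x. norm (f y - f x - f' (y - x)) \<le> 1 * norm (y - x)"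
    using f' unfolding has_derivative_within_alt2 by (meson zero_less_one)
  then have "\<forall>\<^sub>F y in at x. norm (f y - f x) \<le> (onorm f' + 1) * norm (y - x)"
  proof eventually_elim
    case (elim y)
    then show ?case
      using norm_triangle_sub[of "f y - f x" "f' (y - x)"] onorm[OF bl, of "y - x"]
      by (simp add: distrib_right)
  qed
  then have "\<forall>\<^sub>F y in nhds x. norm (f y - f x) \<le> (onorm f' + 1) * norm (y - x)"
    by (simp add: eventually_nhds_conv_at)
  moreover have "onorm f' + 1 \<ge> 0"
    using onorm_pos_le[OF bl] by simp
  ultimately show thesis
    using that by blast
qed

section \<open>Differential equations that switch at a parameter-dependent time\<close>

text \<open>The function \<open>min s c\<close> is a clock that stops at \<open>c\<close>. The
  difference of two such clocks measures how long one trajectory has switched and the other has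
  not.\<close>

lemma has_vector_derivative_min_const:
  "s \<noteq> c \<Longrightarrow> ((\<lambda>s. min s c) has_vector_derivative (if s < c then 1 else 0)) (at s)"
  for s c :: real
proof (cases "s < c")
  case True
  show ?thesis
    by (rule has_vector_derivative_transform_within_open[where f = "\<lambda>s. s" and S = "{..<c}"])
      (use True in \<open>auto intro!: derivative_eq_intros\<close>)
next
  case False
  assume "s \<noteq> c"
  have "((\<lambda>s. min s c) has_vector_derivative 0) (at s)"
    by (rule has_vector_derivative_transform_within_open[where f = "\<lambda>s. c" and S = "{c<..}"])
      (use False \<open>s \<noteq> c\<close> in auto)
  with False show ?thesis by simp
qed

text \<open>An event later by \<open>\<tau> p - T\<close> means following \<open>G1\<close> instead
  of \<open>G2\<close> for that long. Both \<open>C\<close> and \<open>d\<close> are chosen before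
  \<open>t1\<close> and \<open>t2\<close>; only the neighbourhood of \<open>p0\<close> depends on
  these times.\<close>

lemma transition_estimate:
  fixes w :: "real \<Rightarrow> 'b::real_normed_vector \<Rightarrow> 'e::real_normed_vector"
    and \<tau> :: "'b \<Rightarrow> real" and G1 G2 :: "real \<Rightarrow> 'e \<Rightarrow> 'b \<Rightarrow> 'e"
  assumes r: "r > 0" and L: "L \<ge> 0"
    and lipschitz: "\<And>G s s' x x' p p'. G \<in> {G1, G2} \<Longrightarrow>
          \<bar>s - T\<bar> \<le> r \<Longrightarrow> \<bar>s' - T\<bar> \<le> r \<Longrightarrow> norm (x - x0) \<le> r \<Longrightarrow> norm (x' - x0) \<le> r \<Longrightarrow>
          norm (p - p0) \<le> r \<Longrightarrow> norm (p' - p0) \<le> r \<Longrightarrow>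
          norm (G s x p - G s' x' p') \<le> L * (\<bar>s - s'\<bar> + norm (x - x') + norm (p - p'))"
    and interval: "a < T" "T < b"
    and \<tau>: "\<tau> p0 = T" "\<tau> differentiable (at p0)"
    and cont: "\<forall>\<^sub>F p in nhds p0. continuous_on {a..b} (\<lambda>s. w s p)"
    and ode1: "\<forall>\<^sub>F p in nhds p0. \<forall>s. a < s \<longrightarrow> s < b \<longrightarrow> s < \<tau> p \<longrightarrow>
          ((\<lambda>s. w s p) has_vector_derivative G1 s (w s p) p) (at s)"
    and ode2: "\<forall>\<^sub>F p in nhds p0. \<forall>s. a < s \<longrightarrow> s < b \<longrightarrow> \<tau> p < s \<longrightarrow>
          ((\<lambda>s. w s p) has_vector_derivative G2 s (w s p) p) (at s)"
    and x0: "w T p0 = x0"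
    and diff: "\<forall>\<^sub>F t in at_left T. w t differentiable (at p0)"
  obtains C d where "d > 0"
    "\<And>t1 t2. T - d < t1 \<Longrightarrow> t1 < T \<Longrightarrow> T < t2 \<Longrightarrow> t2 < T + d \<Longrightarrow>
      \<forall>\<^sub>F p in nhds p0. norm ((w t2 p - w t1 p) - (w t2 p0 - w t1 p0)
          - (\<tau> p - T) *\<^sub>R (G1 T x0 p0 - G2 T x0 p0)) \<le> C * (t2 - t1) * norm (p - p0)"
proof -
  define g1 where "g1 = G1 T x0 p0"
  define g2 where "g2 = G2 T x0 p0"
  \<comment> \<open>A speed bound for both fields: the values at the event, plus \<open>L\<close>
    times the three increments of size at most \<open>r\<close> in time, state and
    parameter.\<close>
  define K where "K = norm g1 + norm g2 + L * (3 * r)"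
  have K: "K \<ge> 0"
    unfolding K_def using L r by simp
  have at_T: "norm (G s x p - G T x0 p0) \<le> L * (\<bar>s - T\<bar> + norm (x - x0) + norm (p - p0))"
    if "G \<in> {G1, G2}" "\<bar>s - T\<bar> \<le> r" "norm (x - x0) \<le> r" "norm (p - p0) \<le> r" for G s x p
    using lipschitz[of G s T x x0 p p0] that r by simp
  have K_bound: "norm (G s x p) \<le> K"
    if G: "G \<in> {G1, G2}" and le: "\<bar>s - T\<bar> \<le> r" "norm (x - x0) \<le> r" "norm (p - p0) \<le> r" for G s x p
  proof -
    have "norm (G s x p - G T x0 p0) \<le> L * (3 * r)"
      using at_T[OF G le] le L by (elim order_trans) (auto intro!: mult_left_mono)
    moreover have "norm (G T x0 p0) \<le> norm g1 + norm g2"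
      using G unfolding g1_def g2_def by auto
    ultimately show ?thesis
      unfolding K_def using norm_triangle_sub[of "G s x p" "G T x0 p0"] by linarith
  qed

  have "continuous_on {a..b} (\<lambda>s. w s p0)"
    using cont by (rule eventually_nhds_x_imp_x)
  then have "isCont (\<lambda>s. w s p0) T"
    by (rule continuous_on_interior) (use interval in simp)
  then have w_left: "((\<lambda>s. w s p0) \<longlongrightarrow> x0) (at_left T)"
    unfolding isCont_def x0 by (rule tendsto_within_subset) simp
  \<comment> \<open>The working interval reaches from \<open>t\<close> to its mirror image
    \<open>2 * T - t\<close>. The reference trajectory starts within \<open>r / 4\<close> of
    \<open>x0\<close>, so nearby ones start within \<open>r / 2\<close>; the condition on
    \<open>K\<close> leaves them the other \<open>r / 2\<close> to travel. Differentiability at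
    \<open>t\<close> supplies the initial distance estimate.\<close>
  have "\<forall>\<^sub>F t in at_left T. a < t \<and> 2 * T - t < b \<and> T - t < r \<and> K * (2 * (T - t)) < r / 2
      \<and> L * (2 * (T - t)) < 1 / 2 \<and> norm (w t p0 - x0) < r / 4 \<and> w t differentiable (at p0) \<and> t < T"
  proof (intro eventually_conj diff)
    show "\<forall>\<^sub>F t in at_left T. a < t"
      by (rule order_tendstoD[OF tendsto_ident_at]) (use interval in auto)
    show "\<forall>\<^sub>F t in at_left T. 2 * T - t < b"
      by (rule order_tendstoD(2)[where y = "2 * T - T"], intro tendsto_intros) (use interval in auto)
    show "\<forall>\<^sub>F t in at_left T. T - t < r"
      by (rule order_tendstoD(2)[where y = "T - T"], intro tendsto_intros) (use r in auto)
    show "\<forall>\<^sub>F t in at_left T. K * (2 * (T - t)) < r / 2"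
      by (rule order_tendstoD(2)[where y = "K * (2 * (T - T))"], intro tendsto_intros) (use r in auto)
    show "\<forall>\<^sub>F t in at_left T. L * (2 * (T - t)) < 1 / 2"
      by (rule order_tendstoD(2)[where y = "L * (2 * (T - T))"], intro tendsto_intros) auto
    show "\<forall>\<^sub>F t in at_left T. norm (w t p0 - x0) < r / 4"
      by (rule order_tendstoD(2)[where y = "norm (x0 - x0)"], intro tendsto_intros w_left) (use r in auto)
    show "\<forall>\<^sub>F t in at_left T. t < T"
      by (simp add: eventually_at_filter)
  qed
  then obtain a' where a': "a < a'" "2 * T - a' < b" "T - a' < r" "K * (2 * (T - a')) < r / 2"
      "L * (2 * (T - a')) < 1 / 2" "norm (w a' p0 - x0) < r / 4" "w a' differentiable (at p0)" "a' < T"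
    using eventually_happens' trivial_limit_at_left_real by (smt (verit))
  define b' where "b' = 2 * T - a'"
  have near_T: "\<bar>s - T\<bar> \<le> r" if "a' \<le> s" "s \<le> b'" for s
    using that a' unfolding b'_def by linarith

  obtain C0 where C0: "C0 \<ge> 0" "\<forall>\<^sub>F p in nhds p0. norm (w a' p - w a' p0) \<le> C0 * norm (p - p0)"
    using differentiable_imp_eventually_lipschitz[OF a'(7)] by blast
  obtain C1 where C1: "C1 \<ge> 0" "\<forall>\<^sub>F p in nhds p0. norm (\<tau> p - \<tau> p0) \<le> C1 * norm (p - p0)"
    using differentiable_imp_eventually_lipschitz[OF \<tau>(2)] by blast
  \<comment> \<open>\<open>C2\<close> is twice the coefficient left after absorption: initial
    distance, parameter dependence, and the time spent in different phases.\<close>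
  define C2 where "C2 = 2 * C0 + 1 + 4 * K * C1"
  define C3 where "C3 = C1 + C2 + K * C1 + 1"
  have C23: "C2 \<ge> 0" "C3 \<ge> 0"
    unfolding C2_def C3_def using C0 C1 K by simp_all

  \<comment> \<open>\<open>G s p\<close> is the right-hand side along trajectory \<open>p\<close>,
    switching at that trajectory's own event time. The predicate \<open>good\<close> collects what
    holds for parameters near \<open>p0\<close>, so that the estimates can be made for one parameter
    at a time.\<close>
  define G where "G s p = (if s < \<tau> p then G1 else G2) s (w s p) p" for s p
  define good where "good p \<longleftrightarrow> continuous_on {a'..b'} (\<lambda>s. w s p)
      \<and> (\<forall>s. a' < s \<longrightarrow> s < b' \<longrightarrow> s \<noteq> \<tau> p \<longrightarrow> ((\<lambda>s. w s p) has_vector_derivative G s p) (at s))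
      \<and> norm (w a' p - w a' p0) \<le> C0 * norm (p - p0) \<and> \<bar>\<tau> p - T\<bar> \<le> C1 * norm (p - p0)
      \<and> norm (w a' p - x0) < r / 2 \<and> norm (p - p0) \<le> r" for p
  have good: "\<forall>\<^sub>F p in nhds p0. good p"
  proof -
    have "isCont (w a') p0"
      using a'(7) by (rule differentiable_imp_continuous_within)
    then have "((\<lambda>p. norm (w a' p - x0)) \<longlongrightarrow> norm (w a' p0 - x0)) (nhds p0)"
      unfolding continuous_at tendsto_at_iff_tendsto_nhds by (intro tendsto_intros)
    moreover have "norm (w a' p0 - x0) < r / 2"
      using a'(6) r by simp
    ultimately have "\<forall>\<^sub>F p in nhds p0. norm (w a' p - x0) < r / 2"
      by (rule order_tendstoD)
    moreover have "\<forall>\<^sub>F p in nhds p0. norm (p - p0) \<le> r"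
      unfolding eventually_nhds_metric dist_norm using r by (intro exI[of _ r]) auto
    ultimately show ?thesis
      using C0(2) C1(2) cont ode1 ode2
    proof eventually_elim
      case (elim p)
      have "((\<lambda>s. w s p) has_vector_derivative G s p) (at s)"
        if "a' < s" "s < b'" "s \<noteq> \<tau> p" for s
        using elim(6,7) that a'(1,2) unfolding G_def b'_def by (cases "s < \<tau> p") auto
      moreover have "continuous_on {a'..b'} (\<lambda>s. w s p)"
        using elim(5) by (rule continuous_on_subset) (use a'(1,2) b'_def in auto)
      ultimately show ?case
        using elim(1-4) \<tau>(1) unfolding good_def by simp
    qed
  qed
  then have good0: "good p0"
    by (rule eventually_nhds_x_imp_x)

  \<comment> \<open>The Lipschitz bound holds only in the \<open>r\<close>-ball, so the trajectories
    must be kept there before they can be compared.\<close>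
  have confined: "norm (w s p - x0) \<le> r" if "good p" "a' \<le> s" "s \<le> b'" for p s
  proof -
    have "norm (w s p - x0) < r"
    proof (rule stays_in_ball[where a = a' and b = b' and c = "\<tau> p" and K = K and w' = "\<lambda>s. G s p"])
      show "norm (w a' p - x0) + K * (b' - a') < r"
        using that(1) a'(4) unfolding good_def b'_def by simp
    next
      fix s assume "a' < s" "s < b'" "norm (w s p - x0) \<le> r"
      then show "norm (G s p) \<le> K"
        using that(1) near_T unfolding G_def good_def by (intro K_bound) auto
    qed (use that K in \<open>auto simp: good_def\<close>)
    then show ?thesis by simp
  qed
  have G_bound: "norm (G s p) \<le> K" if "good p" "a' \<le> s" "s \<le> b'" for p s
    using that near_T confined unfolding G_def good_def by (intro K_bound) auto

  \<comment> \<open>The last assumption says that both trajectories are in the same phase, since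
    \<open>\<tau> p0 = T\<close>.\<close>
  have G_diff: "norm (G s p - G s p0) \<le> L * (norm (w s p - w s p0) + norm (p - p0))"
    if "good p" "a' \<le> s" "s \<le> b'" "s < \<tau> p \<longleftrightarrow> s < T" for p s
  proof -
    let ?G = "if s < T then G1 else G2"
    have "norm (?G s (w s p) p - ?G s (w s p0) p0)
        \<le> L * (\<bar>s - s\<bar> + norm (w s p - w s p0) + norm (p - p0))"
      using that near_T confined good0 unfolding good_def by (intro lipschitz) auto
    then show ?thesis
      unfolding G_def using that(4) \<tau>(1) by simp
  qed

  \<comment> \<open>In place of Gronwall's lemma: the interval is so short that \<open>L * (b' - a') < 1 / 2\<close>, so the
    Lipschitz term is absorbed by half of the maximal distance.\<close>
  have C2: "norm (w s p - w s p0) \<le> C2 * norm (p - p0)" if p: "good p" and s: "a' \<le> s" "s \<le> b'" for p s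
  proof -
    define n where "n = norm (p - p0)"
    define f where "f s = w s p - w s p0" for s
    have cont_f: "continuous_on {a'..b'} f"
      unfolding f_def using p good0 by (intro continuous_intros) (auto simp: good_def)
    then have "continuous_on {a'..b'} (\<lambda>s. norm (f s))"
      by (intro continuous_intros)
    moreover have "{a'..b'} \<noteq> {}"
      using s by simp
    ultimately obtain u where u: "a' \<le> u" "u \<le> b'"
        and max: "\<And>s. a' \<le> s \<Longrightarrow> s \<le> b' \<Longrightarrow> norm (f s) \<le> norm (f u)"
      using continuous_attains_sup[of "{a'..b'}" "\<lambda>s. norm (f s)"] by auto
    define m where "m = norm (f u)"
    have nonneg: "m \<ge> 0" "n \<ge> 0"
      unfolding m_def n_def by simp_all
    \<comment> \<open>Between the two event times the fields differ by an amount that does not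
      shrink with \<open>n\<close>. The crude bound \<open>2 * K\<close> suffices, because this
      lasts at most \<open>C1 * n\<close>.\<close>
    have "norm (f u - f a') \<le> L * (m + n) * (u - a') + (2 * K) * (max T (\<tau> p) - min T (\<tau> p))"
    proof (rule increment_bound_exceptional_interval[where f' = "\<lambda>s. G s p - G s p0"])
      show "continuous_on {a'..u} f"
        using cont_f by (rule continuous_on_subset) (use u in auto)
      fix s assume s: "a' < s" "s < u"
      show "(f has_vector_derivative G s p - G s p0) (at s)"
        if "s \<noteq> min T (\<tau> p)" "s \<noteq> max T (\<tau> p)"
      proof -
        have "s \<noteq> T" "s \<noteq> \<tau> p"
          using that by (auto simp: min_def max_def split: if_splits)
        then show ?thesis
          unfolding f_def using p good0 s u \<tau>(1)
          by (intro has_vector_derivative_diff) (auto simp: good_def)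
      qed
      show "norm (G s p - G s p0) \<le> L * (m + n)" if "s < min T (\<tau> p) \<or> max T (\<tau> p) < s"
      proof -
        have "norm (G s p - G s p0) \<le> L * (norm (f s) + n)"
          unfolding f_def n_def using that s u p by (intro G_diff) auto
        also have "\<dots> \<le> L * (m + n)"
          using max[of s] s u L unfolding m_def by (intro mult_left_mono) auto
        finally show ?thesis .
      qed
      show "norm (G s p - G s p0) \<le> 2 * K"
        using G_bound[OF p, of s] G_bound[OF good0, of s] s u norm_triangle_ineq4[of "G s p" "G s p0"]
        by linarith
    qed (use u K L nonneg in auto)
    moreover have "L * (m + n) * (u - a') \<le> (m + n) / 2"
    proof -
      have "L * (u - a') \<le> L * (2 * (T - a'))"
        using u L unfolding b'_def by (intro mult_left_mono) auto
      then have "(m + n) * (L * (u - a')) \<le> (m + n) * (1 / 2)"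
        using a'(5) nonneg by (intro mult_left_mono) auto
      then show ?thesis by (simp add: mult_ac)
    qed
    moreover have "2 * K * (max T (\<tau> p) - min T (\<tau> p)) \<le> 2 * K * (C1 * n)"
      using p K unfolding good_def n_def by (intro mult_left_mono) auto
    moreover have "norm (f a') \<le> C0 * n"
      using p unfolding good_def f_def n_def by simp
    moreover have "m \<le> norm (f u - f a') + norm (f a')"
      unfolding m_def using norm_triangle_sub[of "f u" "f a'"] by simp
    ultimately have "m / 2 \<le> (C0 + 1 / 2 + 2 * K * C1) * n"
      by (simp add: algebra_simps)
    then have "m \<le> C2 * n"
      unfolding C2_def by (simp add: algebra_simps)
    then show ?thesis
      using max[OF s] unfolding m_def f_def n_def by simp
  qed

  have drift: "norm (w s p0 - x0) \<le> K * \<bar>s - T\<bar>" if "a' \<le> s" "s \<le> b'" for s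
  proof -
    have "norm (w d p0 - w c p0) \<le> K * (d - c) + K * (T - T)"
      if "a' \<le> c" "c \<le> d" "d \<le> b'" for c d
    proof (rule increment_bound_exceptional_interval[where f' = "\<lambda>s. G s p0"])
      show "continuous_on {c..d} (\<lambda>s. w s p0)"
        by (rule continuous_on_subset[of "{a'..b'}"]) (use good0 that in \<open>auto simp: good_def\<close>)
    qed (use that good0 K \<tau>(1) in \<open>auto intro!: G_bound simp: good_def\<close>)
    from this[of s T] this[of T s] show ?thesis
      using that a'(8) unfolding b'_def x0
      by (cases "s \<le> T") (auto simp: norm_minus_commute x0[symmetric])
  qed

  \<comment> \<open>The first summand stems from the times in equal phases, the second from the gap
    between the event times, after the leading term has been subtracted.\<close>
  define C where "C = L * (C2 + 1) + 2 * (L * C3)"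
  have "\<forall>\<^sub>F p in nhds p0. norm ((w t2 p - w t1 p) - (w t2 p0 - w t1 p0)
      - (\<tau> p - T) *\<^sub>R (G1 T x0 p0 - G2 T x0 p0)) \<le> C * (t2 - t1) * norm (p - p0)"
    if t: "T - (T - a') < t1" "t1 < T" "T < t2" "t2 < T + (T - a')" for t1 t2
  proof -
    have t': "a' < t1" "t2 < b'"
      using t unfolding b'_def by auto
    have "(\<tau> \<longlongrightarrow> T) (nhds p0)"
      using differentiable_imp_continuous_within[OF \<tau>(2)]
      unfolding continuous_at tendsto_at_iff_tendsto_nhds by (simp add: \<tau>(1))
    then have "\<forall>\<^sub>F p in nhds p0. t1 < \<tau> p" "\<forall>\<^sub>F p in nhds p0. \<tau> p < t2"
      using order_tendstoD t by blast+
    with good show ?thesis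
    proof eventually_elim
      case (elim p)
      define n where "n = norm (p - p0)"
      have n: "n \<ge> 0"
        unfolding n_def by simp
      define \<sigma> where "\<sigma> s c = (if s < c then 1 else 0 :: real)" for s c :: real
      \<comment> \<open>The subtracted term has slope \<open>g1 - g2\<close> or its negative exactly
        between the event times. With both of them in \<open>(t1, t2)\<close>, its coefficient is
        \<open>0\<close> at \<open>t1\<close> and \<open>\<tau> p - T\<close> at
        \<open>t2\<close>.\<close>
      define f where "f s = w s p - w s p0 - (min s (\<tau> p) - min s T) *\<^sub>R (g1 - g2)" for s
      define f' where "f' s = G s p - G s p0 - (\<sigma> s (\<tau> p) - \<sigma> s T) *\<^sub>R (g1 - g2)" for s
      let ?lo = "min T (\<tau> p)" and ?hi = "max T (\<tau> p)"
      have "norm (f t2 - f t1) \<le> L * (C2 * n + n) * (t2 - t1) + 2 * (L * (C3 * n)) * (?hi - ?lo)"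
      proof (rule increment_bound_exceptional_interval[where f' = f'])
        show "continuous_on {t1..t2} f"
        proof (rule continuous_on_subset)
          show "continuous_on {a'..b'} f"
            unfolding f_def using elim(1) good0 by (intro continuous_intros) (auto simp: good_def)
        qed (use t' in auto)
        fix s assume s: "t1 < s" "s < t2"
        then have s': "a' \<le> s" "s \<le> b'"
          using t' by auto
        show "(f has_vector_derivative f' s) (at s)" if "s \<noteq> ?lo" "s \<noteq> ?hi"
        proof -
          have "s \<noteq> T" "s \<noteq> \<tau> p"
            using that by (auto simp: min_def max_def split: if_splits)
          then show ?thesis
            unfolding f_def f'_def \<sigma>_def using elim(1) good0 s t' \<tau>(1)
            by (intro has_vector_derivative_diff has_vector_derivative_min_const
                bounded_linear.has_vector_derivative[OF bounded_linear_scaleR_left])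
              (auto simp: good_def)
        qed
        show "norm (f' s) \<le> L * (C2 * n + n)" if "s < ?lo \<or> ?hi < s"
        proof -
          have "\<sigma> s (\<tau> p) = \<sigma> s T"
            using that unfolding \<sigma>_def by auto
          then have "norm (f' s) = norm (G s p - G s p0)"
            unfolding f'_def by simp
          also have "\<dots> \<le> L * (norm (w s p - w s p0) + n)"
            unfolding n_def using that s' elim(1) by (intro G_diff) auto
          also have "\<dots> \<le> L * (C2 * n + n)"
            using C2[OF elim(1) s'] L unfolding n_def by (intro mult_left_mono) auto
          finally show ?thesis .
        qed
        show "norm (f' s) \<le> 2 * (L * (C3 * n))" if sT: "?lo < s" "s < ?hi"
        proof -
          have "\<bar>s - T\<bar> \<le> \<bar>\<tau> p - T\<bar>"
            using sT by (auto simp: min_def max_def split: if_splits)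
          then have sT': "\<bar>s - T\<bar> \<le> C1 * n"
            using elim(1) unfolding good_def n_def by simp
          \<comment> \<open>Between the event times everything is within order \<open>n\<close> of
            the event: time by \<open>C1 * n\<close>, state by \<open>(C2 + K * C1) * n\<close>,
            parameter by \<open>n\<close>. The sum is \<open>C3 * n\<close>, so each field is close
            to its value frozen at the event.\<close>
          have dev: "norm (H s (w s p') p' - H T x0 p0) \<le> L * (C3 * n)"
            if "H \<in> {G1, G2}" "p' \<in> {p, p0}" for H p'
          proof -
            have p': "good p'" "norm (p' - p0) \<le> n"
              using that elim(1) good0 unfolding n_def by auto
            have "norm (w s p' - w s p0) \<le> C2 * norm (p' - p0)"
              by (rule C2[OF p'(1) s'])
            also have "\<dots> \<le> C2 * n"
              using p' C23 by (intro mult_left_mono) auto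
            finally have "norm (w s p' - x0) \<le> C2 * n + K * \<bar>s - T\<bar>"
              using drift[OF s'] norm_triangle_ineq[of "w s p' - w s p0" "w s p0 - x0"] by simp
            moreover have "K * \<bar>s - T\<bar> \<le> K * (C1 * n)"
              using sT' K by (intro mult_left_mono) auto
            ultimately have "\<bar>s - T\<bar> + norm (w s p' - x0) + norm (p' - p0) \<le> C3 * n"
              using sT' p'(2) unfolding C3_def by (simp add: algebra_simps)
            then have "L * (\<bar>s - T\<bar> + norm (w s p' - x0) + norm (p' - p0)) \<le> L * (C3 * n)"
              using L by (intro mult_left_mono) auto
            moreover have "norm (H s (w s p') p' - H T x0 p0)
                \<le> L * (\<bar>s - T\<bar> + norm (w s p' - x0) + norm (p' - p0))"
              using that(1) near_T[OF s'] confined[OF p'(1) s'] p'(1)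
              by (intro at_T) (auto simp: good_def)
            ultimately show ?thesis by simp
          qed
          consider "\<tau> p < s" "s < T" | "T < s" "s < \<tau> p"
            using sT by (auto simp: min_def max_def split: if_splits)
          then show ?thesis
          proof cases
            case 1
            then have "f' s = (G2 s (w s p) p - g2) - (G1 s (w s p0) p0 - g1)"
              unfolding f'_def \<sigma>_def G_def using \<tau>(1) by (simp add: algebra_simps)
            then show ?thesis
              using dev[of G2 p] dev[of G1 p0] norm_triangle_ineq4 unfolding g1_def g2_def
              by (smt (verit) insert_iff)
          next
            case 2
            then have "f' s = (G1 s (w s p) p - g1) - (G2 s (w s p0) p0 - g2)"
              unfolding f'_def \<sigma>_def G_def using \<tau>(1) by (simp add: algebra_simps)
            then show ?thesis
              using dev[of G1 p] dev[of G2 p0] norm_triangle_ineq4 unfolding g1_def g2_def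
              by (smt (verit) insert_iff)
          qed
        qed
      qed (use t L C23 n in auto)
      \<comment> \<open>Both event times lie in \<open>(t1, t2)\<close>, so the gap is bounded by
        \<open>t2 - t1\<close>, which is the factor wanted.\<close>
      also have "\<dots> \<le> L * (C2 * n + n) * (t2 - t1) + 2 * (L * (C3 * n)) * (t2 - t1)"
        using t elim(2,3) L C23 n by (intro add_left_mono mult_left_mono) auto
      also have "\<dots> = C * (t2 - t1) * n"
        unfolding C_def by (simp add: algebra_simps)
      finally show ?case
        using t elim(2,3) unfolding f_def n_def g1_def g2_def by (simp add: algebra_simps)
    qed
  qed
  then show thesis
    using that[of "T - a'" C] a'(8) by simp
qed

section \<open>Equations of motion as a first-order system\<close>

lemma bounded_bilinear_matrix_vector_mult:
  "bounded_bilinear ((*v) :: real^'m^'n \<Rightarrow> real^'m \<Rightarrow> real^'n)"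
  unfolding bilinear_conv_bounded_bilinear[symmetric] bilinear_def
  by (auto intro!: linearI simp: algebra_simps scaleR_matrix_vector_assoc)

text \<open>The first-order form on states \<open>x = (q, v)\<close>. Its position component is the
  same in both phases, so at a common state two phases differ only in the velocity
  component.\<close>

definition phase_field :: "('n::finite, 'p::finite) mass \<Rightarrow> ('n, 'p) force \<Rightarrow>
    real \<Rightarrow> (real^'n) \<times> (real^'n) \<Rightarrow> real^'p \<Rightarrow> (real^'n) \<times> (real^'n)" where
  "phase_field M F t x \<rho> = (snd x, eom M F t (fst x) (snd x) \<rho>)"

text \<open>The acceleration is a bilinear product of the inverse mass matrix and the force, each of
  which is continuously differentiable by \<open>regular_eom\<close>.\<close>

lemma phase_field_locally_lipschitz:
  fixes M :: "('n::finite, 'p::finite) mass" and F :: "('n, 'p) force"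
  assumes regular: "regular_eom T P M F" and "open T" "open P" and t: "t \<in> T" "\<rho> \<in> P"
  obtains e L where "e > 0"
    "L-lipschitz_on (cball (t, x, \<rho>) e) (\<lambda>(t, x, \<rho>). phase_field M F t x \<rho>)"
proof -
  obtain q v where x: "x = (q, v)"
    by fastforce
  have C1: "C_k_on (Suc 0) (\<lambda>(t, q, \<rho>). matrix_inv (M t q \<rho>)) (T \<times> UNIV \<times> P)"
      "C_k_on (Suc 0) (\<lambda>(t, q, v, \<rho>). F t q v \<rho>) (T \<times> UNIV \<times> UNIV \<times> P)"
    using regular unfolding regular_eom_def smooth_on_def by blast+
  obtain e1 L1 where e1: "e1 > 0"
    and L1: "L1-lipschitz_on (cball (t, q, \<rho>) e1) (\<lambda>(t, q, \<rho>). matrix_inv (M t q \<rho>))"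
    by (rule C_1_on_imp_locally_lipschitz[OF C1(1), of "(t, q, \<rho>)"])
      (use assms in \<open>auto intro: open_Times\<close>)
  obtain e2 L2 where e2: "e2 > 0"
    and L2: "L2-lipschitz_on (cball (t, q, v, \<rho>) e2) (\<lambda>(t, q, v, \<rho>). F t q v \<rho>)"
    by (rule C_1_on_imp_locally_lipschitz[OF C1(2), of "(t, q, v, \<rho>)"])
      (use assms in \<open>auto intro: open_Times\<close>)
  define e where "e = min e1 e2"
  let ?U = "cball (t, x, \<rho>) e"
  \<comment> \<open>\<open>\<pi>\<close> and \<open>\<kappa>\<close> rearrange the arguments for
    mass and force. Neither increases distances, so the Lipschitz constants carry over.\<close>
  define \<pi> :: "real \<times> ((real^'n) \<times> (real^'n)) \<times> (real^'p) \<Rightarrow> real \<times> (real^'n) \<times> (real^'p)"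
    where "\<pi> = (\<lambda>(t, (q, v), \<rho>). (t, q, \<rho>))"
  define \<kappa> :: "real \<times> ((real^'n) \<times> (real^'n)) \<times> (real^'p) \<Rightarrow>
      real \<times> (real^'n) \<times> (real^'n) \<times> (real^'p)"
    where "\<kappa> = (\<lambda>(t, (q, v), \<rho>). (t, q, v, \<rho>))"
  have \<pi>: "dist (\<pi> y) (\<pi> z) \<le> dist y z" for y z
    unfolding \<pi>_def by (auto simp: dist_Pair_Pair split: prod.splits)
  have \<kappa>: "dist (\<kappa> y) (\<kappa> z) = dist y z" for y z
    unfolding \<kappa>_def by (auto simp: dist_Pair_Pair add.assoc split: prod.splits)
  have "\<pi> ` ?U \<subseteq> cball (t, q, \<rho>) e1"
  proof
    fix y assume "y \<in> \<pi> ` ?U"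
    then obtain z where "y = \<pi> z" "dist (t, x, \<rho>) z \<le> e" by auto
    then show "y \<in> cball (t, q, \<rho>) e1"
      using \<pi>[of "(t, x, \<rho>)" z] unfolding e_def by (simp add: \<pi>_def x)
  qed
  then have "(L1 * 1)-lipschitz_on ?U (\<lambda>z. (\<lambda>(t, q, \<rho>). matrix_inv (M t q \<rho>)) (\<pi> z))"
    using lipschitz_on_subset[OF L1] \<pi>
    by (intro lipschitz_on_compose2) (auto intro: lipschitz_onI)
  moreover have "\<kappa> ` ?U \<subseteq> cball (t, q, v, \<rho>) e2"
  proof
    fix y assume "y \<in> \<kappa> ` ?U"
    then obtain z where "y = \<kappa> z" "dist (t, x, \<rho>) z \<le> e" by auto
    then show "y \<in> cball (t, q, v, \<rho>) e2"
      using \<kappa>[of "(t, x, \<rho>)" z] unfolding e_def by (simp add: \<kappa>_def x)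
  qed
  then have "(L2 * 1)-lipschitz_on ?U (\<lambda>z. (\<lambda>(t, q, v, \<rho>). F t q v \<rho>) (\<kappa> z))"
    using lipschitz_on_subset[OF L2] \<kappa>
    by (intro lipschitz_on_compose2) (auto intro: lipschitz_onI)
  ultimately obtain C where C: "C-lipschitz_on ?U (\<lambda>z. (\<lambda>(t, q, \<rho>). matrix_inv (M t q \<rho>)) (\<pi> z) *v
      (\<lambda>(t, q, v, \<rho>). F t q v \<rho>) (\<kappa> z))"
    by (rule bounded_bilinear.lipschitz_on_cball_prod[OF bounded_bilinear_matrix_vector_mult])
  have "1-lipschitz_on ?U (\<lambda>(t, x, \<rho>). snd x)"
  proof (rule lipschitz_onI)
    fix y z :: "real \<times> ((real^'n) \<times> (real^'n)) \<times> (real^'p)"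
    have "dist (snd (fst (snd y))) (snd (fst (snd z))) \<le> dist y z"
      by (meson dist_fst_le dist_snd_le order_trans)
    then show "dist (case y of (t, x, \<rho>) \<Rightarrow> snd x) (case z of (t, x, \<rho>) \<Rightarrow> snd x) \<le> 1 * dist y z"
      by (simp add: case_prod_beta)
  qed simp
  from lipschitz_on_Pair[OF this C]
  have "(sqrt (1\<^sup>2 + C\<^sup>2))-lipschitz_on ?U (\<lambda>(t, x, \<rho>). phase_field M F t x \<rho>)"
    by (rule lipschitz_on_transform) (auto simp: phase_field_def eom_def \<pi>_def \<kappa>_def)
  moreover have "e > 0"
    unfolding e_def using e1 e2 by simp
  ultimately show thesis
    by (intro that)
qed

lemma phase_field_lipschitz_bound:
  fixes M :: "('n::finite, 'p::finite) mass" and F :: "('n, 'p) force"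
  assumes "regular_eom T P M F" "open T" "open P" "t \<in> T" "\<rho> \<in> P"
  obtains r L where "r > 0" "L \<ge> 0"
    "\<And>s s' y y' p p'. \<bar>s - t\<bar> \<le> r \<Longrightarrow> \<bar>s' - t\<bar> \<le> r \<Longrightarrow> norm (y - x) \<le> r \<Longrightarrow> norm (y' - x) \<le> r \<Longrightarrow>
      norm (p - \<rho>) \<le> r \<Longrightarrow> norm (p' - \<rho>) \<le> r \<Longrightarrow>
      norm (phase_field M F s y p - phase_field M F s' y' p')
        \<le> L * (\<bar>s - s'\<bar> + norm (y - y') + norm (p - p'))"
proof -
  obtain e L where e: "e > 0"
    and L: "L-lipschitz_on (cball (t, x, \<rho>) e) (\<lambda>(t, x, \<rho>). phase_field M F t x \<rho>)"
    by (rule phase_field_locally_lipschitz[OF assms])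
  have sum: "dist (s, y, p) (s', y', p') \<le> \<bar>s - s'\<bar> + norm (y - y') + norm (p - p')"
    for s s' :: real and y y' :: "(real^'n) \<times> (real^'n)" and p p' :: "real^'p"
    using norm_Pair_le[of "s - s'" "(y - y', p - p')"] norm_Pair_le[of "y - y'" "p - p'"]
    by (simp add: dist_norm)
  \<comment> \<open>Three increments of at most \<open>e / 3\<close> add up to a point of the
    ball.\<close>
  have mem: "(s, y, p) \<in> cball (t, x, \<rho>) e"
    if "\<bar>s - t\<bar> \<le> e / 3" "norm (y - x) \<le> e / 3" "norm (p - \<rho>) \<le> e / 3" for s y p
    using sum[of s y p t x \<rho>] that by (simp add: dist_commute)
  have "norm (phase_field M F s y p - phase_field M F s' y' p')
      \<le> L * (\<bar>s - s'\<bar> + norm (y - y') + norm (p - p'))"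
    if "\<bar>s - t\<bar> \<le> e / 3" "\<bar>s' - t\<bar> \<le> e / 3" "norm (y - x) \<le> e / 3" "norm (y' - x) \<le> e / 3"
      "norm (p - \<rho>) \<le> e / 3" "norm (p' - \<rho>) \<le> e / 3" for s s' y y' p p'
  proof -
    have "norm (phase_field M F s y p - phase_field M F s' y' p')
        \<le> L * norm ((s, y, p) - (s', y', p'))"
      using lipschitz_on_normD[OF L mem mem] that by simp
    also have "\<dots> \<le> L * (\<bar>s - s'\<bar> + norm (y - y') + norm (p - p'))"
      using sum lipschitz_on_nonneg[OF L] unfolding dist_norm by (intro mult_left_mono)
    finally show ?thesis .
  qed
  with e lipschitz_on_nonneg[OF L] show thesis
    by (intro that[of "e / 3" L]) auto
qed

section \<open>The hybrid system near an event\<close>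

context hybrid_system
begin

lemma times_mono:
  assumes "i \<le> j" "j \<le> Suc N" "\<rho> \<in> P"
  shows "\<tau> i \<rho> \<le> \<tau> j \<rho>"
  using assms(1,2)
proof (induction rule: dec_induct)
  case (step n)
  then show ?case
    using times_increasing[of n \<rho>] assms(3) by simp
qed simp

lemma times_bounds:
  assumes "j \<le> Suc N" "\<rho> \<in> P"
  shows "t0 \<le> \<tau> j \<rho>" "\<tau> j \<rho> \<le> tF"
  using times_mono[of 0 j \<rho>] times_mono[of j "Suc N" \<rho>] first_time last_time assms by auto

lemma times_tendsto:
  assumes "j \<le> Suc N" "\<rho> \<in> P"
  shows "(\<tau> j \<longlongrightarrow> \<tau> j \<rho>) (nhds \<rho>)"
  using times_continuous[OF assms(1)] open_parameters assms(2)
  by (simp add: continuous_on_eq_continuous_at continuous_at tendsto_at_iff_tendsto_nhds)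

text \<open>The nested derivative requires the inner one to equal \<open>v\<close> on a
  neighbourhood of \<open>t\<close>; the open phase is such a neighbourhood.\<close>

lemma acceleration_eq:
  assumes "k \<le> N" "\<rho> \<in> P" "t \<in> {\<tau> k \<rho><..<\<tau> (Suc k) \<rho>}"
  shows "acceleration q \<rho> t = eom (M k) (F k) t (q t \<rho>) (v t \<rho>) \<rho>"
proof -
  have "((\<lambda>s. vector_derivative (\<lambda>u. q u \<rho>) (at s)) has_vector_derivative
      eom (M k) (F k) t (q t \<rho>) (v t \<rho>) \<rho>) (at t)"
  proof (rule has_vector_derivative_transform_within_open[OF velocity_ode[OF assms]])
    fix s assume "s \<in> {\<tau> k \<rho><..<\<tau> (Suc k) \<rho>}"
    then show "v s \<rho> = vector_derivative (\<lambda>u. q u \<rho>) (at s)"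
      using vector_derivative_at[OF position_ode[OF assms(1,2)]] by simp
  qed (use assms(3) in auto)
  then show ?thesis
    unfolding acceleration_def by (rule vector_derivative_at)
qed

end

text \<open>At the event time itself the velocity carries no information, so the state is completed
  there by the common one-sided limit; this makes it continuous in time.\<close>

definition completed_state where
  "completed_state q v t_eve l t \<rho> = (q t \<rho>, if t = t_eve \<rho> then l \<rho> else v t \<rho>)"

context hybrid_system
begin

lemma position_isCont:
  assumes "k < N" "\<rho> \<in> P" "\<tau> k \<rho> < t" "t < \<tau> (Suc (Suc k)) \<rho>"
  shows "isCont (\<lambda>s. q s \<rho>) t"
proof (rule continuous_on_interior[OF position_continuous])
  show "t \<in> interior {t0..tF}"
    using times_bounds[of k \<rho>] times_bounds[of "Suc (Suc k)" \<rho>] assms by simp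
qed fact

lemma completed_state_isCont:
  assumes k: "k < N" and \<rho>: "\<rho> \<in> P" and t: "\<tau> k \<rho> < t" "t < \<tau> (Suc (Suc k)) \<rho>"
    and l: "((\<lambda>t. v t \<rho>) \<longlongrightarrow> l \<rho>) (at (\<tau> (Suc k) \<rho>))"
  shows "isCont (\<lambda>s. completed_state q v (\<tau> (Suc k)) l s \<rho>) t"
proof -
  have "((\<lambda>s. if s = \<tau> (Suc k) \<rho> then l \<rho> else v s \<rho>) \<longlongrightarrow>
      (if t = \<tau> (Suc k) \<rho> then l \<rho> else v t \<rho>)) (at t)"
  proof (cases "t = \<tau> (Suc k) \<rho>")
    case True
    have "\<forall>\<^sub>F s in at t. v s \<rho> = (if s = \<tau> (Suc k) \<rho> then l \<rho> else v s \<rho>)"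
      using True by (simp add: eventually_at_filter)
    with l True show ?thesis
      by (simp add: tendsto_cong)
  next
    case False
    have "((\<lambda>s. v s \<rho>) has_vector_derivative eom (M j) (F j) t (q t \<rho>) (v t \<rho>) \<rho>) (at t)"
      if "j = (if t < \<tau> (Suc k) \<rho> then k else Suc k)" for j
      by (rule velocity_ode) (use that False k \<rho> t in \<open>auto split: if_splits\<close>)
    then have "isCont (\<lambda>s. v s \<rho>) t"
      using has_vector_derivative_continuous by blast
    moreover have "\<forall>\<^sub>F s in at t. s \<noteq> \<tau> (Suc k) \<rho>"
      using False by (intro tendsto_imp_eventually_ne) auto
    then have "\<forall>\<^sub>F s in at t. v s \<rho> = (if s = \<tau> (Suc k) \<rho> then l \<rho> else v s \<rho>)"
      by eventually_elim simp
    ultimately show ?thesis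
      using False by (simp add: isCont_def tendsto_cong)
  qed
  moreover have "((\<lambda>s. q s \<rho>) \<longlongrightarrow> q t \<rho>) (at t)"
    using position_isCont[OF k \<rho> t] by (simp add: isCont_def)
  ultimately show ?thesis
    unfolding isCont_def completed_state_def by (intro tendsto_Pair)
qed

text \<open>The completed event may be either end of the phase, so the lemma serves the phase before
  the event and the phase after it.\<close>

lemma completed_state_ode:
  assumes "k \<le> N" "\<rho> \<in> P" "t \<in> {\<tau> k \<rho><..<\<tau> (Suc k) \<rho>}"
    and j: "j = k \<or> j = Suc k"
  shows "((\<lambda>s. completed_state q v (\<tau> j) l s \<rho>) has_vector_derivative
    phase_field (M k) (F k) t (completed_state q v (\<tau> j) l t \<rho>) \<rho>) (at t)"
proof (rule has_vector_derivative_transform_within_open[where S = "{\<tau> k \<rho><..<\<tau> (Suc k) \<rho>}"])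
  show "((\<lambda>s. (q s \<rho>, v s \<rho>)) has_vector_derivative
      phase_field (M k) (F k) t (completed_state q v (\<tau> j) l t \<rho>) \<rho>) (at t)"
    using has_vector_derivative_Pair[OF position_ode velocity_ode, OF assms(1-3) assms(1-3)] assms(3) j
    by (auto simp: phase_field_def completed_state_def)
qed (use assms(3) j in \<open>auto simp: completed_state_def\<close>)

text \<open>\<open>transition_estimate\<close> is applied to the completed state and then projected
  to the velocity. At \<open>t1\<close> and \<open>t2\<close>, which are not event times for
  \<open>p\<close> near \<open>\<rho>\<close>, the completion leaves the velocity unchanged.\<close>

lemma eom_change_estimate:
  assumes k: "k < N" and \<rho>: "\<rho> \<in> P"
    and limit: "\<And>\<rho>'. \<rho>' \<in> P \<Longrightarrow>
          \<exists>l. ((\<lambda>t. v t \<rho>') \<longlongrightarrow> l) (at_left (\<tau> (Suc k) \<rho>')) \<and>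
              ((\<lambda>t. v t \<rho>') \<longlongrightarrow> l) (at_right (\<tau> (Suc k) \<rho>'))"
    and v_eve: "((\<lambda>t. v t \<rho>) \<longlongrightarrow> v_eve) (at (\<tau> (Suc k) \<rho>))"
    and \<tau>: "\<tau> (Suc k) differentiable (at \<rho>)"
    and v_diff: "\<forall>\<^sub>F t in at_left (\<tau> (Suc k) \<rho>). v t differentiable (at \<rho>)"
    and q_diff: "\<forall>\<^sub>F t in at_left (\<tau> (Suc k) \<rho>). q t differentiable (at \<rho>)"
  defines "T \<equiv> \<tau> (Suc k) \<rho>"
  defines "jump \<equiv> eom (M k) (F k) T (q T \<rho>) v_eve \<rho> - eom (M (Suc k)) (F (Suc k)) T (q T \<rho>) v_eve \<rho>"
  obtains C d where "d > 0"
    "\<And>t1 t2. T - d < t1 \<Longrightarrow> t1 < T \<Longrightarrow> T < t2 \<Longrightarrow> t2 < T + d \<Longrightarrow>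
      \<forall>\<^sub>F p in nhds \<rho>. norm ((v t2 p - v t1 p) - (v t2 \<rho> - v t1 \<rho>)
          - (\<tau> (Suc k) p - T) *\<^sub>R jump) \<le> C * (t2 - t1) * norm (p - \<rho>)"
proof -
  have "\<exists>l. ((\<lambda>t. v t \<rho>') \<longlongrightarrow> l) (at (\<tau> (Suc k) \<rho>'))" if "\<rho>' \<in> P" for \<rho>'
    using limit[OF that] filterlim_split_at by blast
  then obtain l where l: "\<And>\<rho>'. \<rho>' \<in> P \<Longrightarrow> ((\<lambda>t. v t \<rho>') \<longlongrightarrow> l \<rho>') (at (\<tau> (Suc k) \<rho>'))"
    by metis
  have l_eve: "l \<rho> = v_eve"
    using tendsto_unique[OF trivial_limit_at l[OF \<rho>] v_eve] .
  define w where "w = completed_state q v (\<tau> (Suc k)) l"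
  have w_T: "w T \<rho> = (q T \<rho>, v_eve)"
    unfolding w_def completed_state_def T_def l_eve by simp
  have w_snd: "snd (w t p) = v t p" if "t \<noteq> \<tau> (Suc k) p" for t p
    using that unfolding w_def completed_state_def by simp

  have "\<tau> k \<rho> < T" "T < \<tau> (Suc (Suc k)) \<rho>"
    using times_increasing[of k \<rho>] times_increasing[of "Suc k" \<rho>] k \<rho> unfolding T_def by auto
  then obtain a b where ab: "\<tau> k \<rho> < a" "a < T" "T < b" "b < \<tau> (Suc (Suc k)) \<rho>"
    using dense by metis
  have T: "T \<in> {t0<..<tF}"
    using ab times_bounds[of k \<rho>] times_bounds[of "Suc (Suc k)" \<rho>] k \<rho> by auto
  \<comment> \<open>By continuity of the event times the neighbouring events stay outside
    \<open>[a, b]\<close>, so nearby trajectories meet only event \<open>Suc k\<close>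
    there.\<close>
  have "\<forall>\<^sub>F p in nhds \<rho>. \<tau> k p < a"
    by (rule order_tendstoD[OF times_tendsto]) (use k \<rho> ab in auto)
  moreover have "\<forall>\<^sub>F p in nhds \<rho>. b < \<tau> (Suc (Suc k)) p"
    by (rule order_tendstoD[OF times_tendsto]) (use k \<rho> ab in auto)
  moreover have "\<forall>\<^sub>F p in nhds \<rho>. p \<in> P"
    using open_parameters \<rho> by (rule eventually_nhds_in_open)
  ultimately have near: "\<forall>\<^sub>F p in nhds \<rho>. p \<in> P \<and> \<tau> k p < a \<and> b < \<tau> (Suc (Suc k)) p"
    by eventually_elim simp

  note regular_k = regular[of k] regular[of "Suc k"]
  obtain r1 L1 where r1: "r1 > 0" "L1 \<ge> 0" and lip1:
    "\<And>s s' y y' p p'. \<bar>s - T\<bar> \<le> r1 \<Longrightarrow> \<bar>s' - T\<bar> \<le> r1 \<Longrightarrow> norm (y - w T \<rho>) \<le> r1 \<Longrightarrow>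
      norm (y' - w T \<rho>) \<le> r1 \<Longrightarrow> norm (p - \<rho>) \<le> r1 \<Longrightarrow> norm (p' - \<rho>) \<le> r1 \<Longrightarrow>
      norm (phase_field (M k) (F k) s y p - phase_field (M k) (F k) s' y' p')
        \<le> L1 * (\<bar>s - s'\<bar> + norm (y - y') + norm (p - p'))"
    using phase_field_lipschitz_bound[OF regular_k(1) open_greaterThanLessThan open_parameters T \<rho>] k
    by (metis less_imp_le)
  obtain r2 L2 where r2: "r2 > 0" "L2 \<ge> 0" and lip2:
    "\<And>s s' y y' p p'. \<bar>s - T\<bar> \<le> r2 \<Longrightarrow> \<bar>s' - T\<bar> \<le> r2 \<Longrightarrow> norm (y - w T \<rho>) \<le> r2 \<Longrightarrow>
      norm (y' - w T \<rho>) \<le> r2 \<Longrightarrow> norm (p - \<rho>) \<le> r2 \<Longrightarrow> norm (p' - \<rho>) \<le> r2 \<Longrightarrow>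
      norm (phase_field (M (Suc k)) (F (Suc k)) s y p - phase_field (M (Suc k)) (F (Suc k)) s' y' p')
        \<le> L2 * (\<bar>s - s'\<bar> + norm (y - y') + norm (p - p'))"
    using phase_field_lipschitz_bound[OF regular_k(2) open_greaterThanLessThan open_parameters T \<rho>] k
    by (metis Suc_leI)
  define r where "r = min r1 r2"
  define L where "L = max L1 L2"

  obtain C d where d: "d > 0" and est:
    "\<And>t1 t2. T - d < t1 \<Longrightarrow> t1 < T \<Longrightarrow> T < t2 \<Longrightarrow> t2 < T + d \<Longrightarrow>
      \<forall>\<^sub>F p in nhds \<rho>. norm ((w t2 p - w t1 p) - (w t2 \<rho> - w t1 \<rho>)
          - (\<tau> (Suc k) p - T) *\<^sub>R (phase_field (M k) (F k) T (w T \<rho>) \<rho>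
            - phase_field (M (Suc k)) (F (Suc k)) T (w T \<rho>) \<rho>)) \<le> C * (t2 - t1) * norm (p - \<rho>)"
  proof (rule transition_estimate[where w = w and \<tau> = "\<tau> (Suc k)" and ?p0.0 = \<rho> and T = T
        and ?G1.0 = "phase_field (M k) (F k)" and ?G2.0 = "phase_field (M (Suc k)) (F (Suc k))"
        and ?x0.0 = "w T \<rho>" and r = r and L = L and a = a and b = b])
    show "r > 0" "L \<ge> 0"
      unfolding r_def L_def using r1 r2 by auto
  next
    fix G s s' x x' p p'
    assume G: "G \<in> {phase_field (M k) (F k), phase_field (M (Suc k)) (F (Suc k))}"
      and le: "\<bar>s - T\<bar> \<le> r" "\<bar>s' - T\<bar> \<le> r" "norm (x - w T \<rho>) \<le> r" "norm (x' - w T \<rho>) \<le> r"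
        "norm (p - \<rho>) \<le> r" "norm (p' - \<rho>) \<le> r"
    have "norm (G s x p - G s' x' p') \<le> L1 * (\<bar>s - s'\<bar> + norm (x - x') + norm (p - p'))
        \<or> norm (G s x p - G s' x' p') \<le> L2 * (\<bar>s - s'\<bar> + norm (x - x') + norm (p - p'))"
      using G lip1[of s s' x x' p p'] lip2[of s s' x x' p p'] le unfolding r_def by auto
    moreover have "L1 * (\<bar>s - s'\<bar> + norm (x - x') + norm (p - p')) \<le> L * (\<bar>s - s'\<bar> + norm (x - x') + norm (p - p'))"
      "L2 * (\<bar>s - s'\<bar> + norm (x - x') + norm (p - p')) \<le> L * (\<bar>s - s'\<bar> + norm (x - x') + norm (p - p'))"
      unfolding L_def by (intro mult_right_mono; simp)+
    ultimately show "norm (G s x p - G s' x' p') \<le> L * (\<bar>s - s'\<bar> + norm (x - x') + norm (p - p'))"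
      by linarith
  next
    show "a < T" "T < b" "\<tau> (Suc k) \<rho> = T" "\<tau> (Suc k) differentiable (at \<rho>)" "w T \<rho> = w T \<rho>"
      using ab \<tau> unfolding T_def by simp_all
  next
    show "\<forall>\<^sub>F p in nhds \<rho>. continuous_on {a..b} (\<lambda>s. w s p)"
      using near
    proof eventually_elim
      case (elim p)
      have "isCont (\<lambda>s. w s p) s" if "s \<in> {a..b}" for s
        unfolding w_def using elim k l that by (intro completed_state_isCont) auto
      then show ?case
        by (intro continuous_at_imp_continuous_on ballI)
    qed
  next
    show "\<forall>\<^sub>F p in nhds \<rho>. \<forall>s. a < s \<longrightarrow> s < b \<longrightarrow> s < \<tau> (Suc k) p \<longrightarrow>
        ((\<lambda>s. w s p) has_vector_derivative phase_field (M k) (F k) s (w s p) p) (at s)"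
      using near unfolding w_def
      by eventually_elim (use k in \<open>auto intro!: completed_state_ode\<close>)
  next
    show "\<forall>\<^sub>F p in nhds \<rho>. \<forall>s. a < s \<longrightarrow> s < b \<longrightarrow> \<tau> (Suc k) p < s \<longrightarrow>
        ((\<lambda>s. w s p) has_vector_derivative phase_field (M (Suc k)) (F (Suc k)) s (w s p) p) (at s)"
      using near unfolding w_def
      by eventually_elim (use k in \<open>auto intro!: completed_state_ode\<close>)
  next
    have "\<forall>\<^sub>F t in at_left T. t < T"
      by (simp add: eventually_at_filter)
    with v_diff q_diff show "\<forall>\<^sub>F t in at_left T. w t differentiable (at \<rho>)"
      unfolding T_def[symmetric]
    proof eventually_elim
      case (elim t)
      \<comment> \<open>For fixed \<open>t < T\<close> no nearby trajectory has its event at time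
        \<open>t\<close>, so the completion leaves the dependence on \<open>p\<close> near
        \<open>\<rho>\<close> unchanged.\<close>
      have "\<forall>\<^sub>F p in nhds \<rho>. t < \<tau> (Suc k) p"
        by (rule order_tendstoD[OF times_tendsto]) (use k \<rho> elim(3) in \<open>auto simp: T_def\<close>)
      then have "\<forall>\<^sub>F p in nhds \<rho>. (q t p, v t p) = w t p"
        by eventually_elim (auto simp: w_def completed_state_def)
      moreover have "(\<lambda>p. (q t p, v t p)) differentiable (at \<rho>)"
        using elim(1,2) unfolding differentiable_def by (blast intro: has_derivative_Pair)
      ultimately show ?case
        unfolding differentiable_def eventually_nhds_conv_at
        by (blast intro: has_derivative_transform_eventually)
    qed
  qed (rule that)

  have "\<forall>\<^sub>F p in nhds \<rho>. norm ((v t2 p - v t1 p) - (v t2 \<rho> - v t1 \<rho>)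
          - (\<tau> (Suc k) p - T) *\<^sub>R jump) \<le> C * (t2 - t1) * norm (p - \<rho>)"
    if t: "T - d < t1" "t1 < T" "T < t2" "t2 < T + d" for t1 t2
  proof -
    have "\<forall>\<^sub>F p in nhds \<rho>. t1 < \<tau> (Suc k) p"
      by (rule order_tendstoD[OF times_tendsto]) (use k \<rho> t in \<open>auto simp: T_def\<close>)
    moreover have "\<forall>\<^sub>F p in nhds \<rho>. \<tau> (Suc k) p < t2"
      by (rule order_tendstoD[OF times_tendsto]) (use k \<rho> t in \<open>auto simp: T_def\<close>)
    ultimately show ?thesis
      using est[OF t]
    proof eventually_elim
      case (elim p)
      let ?X = "(w t2 p - w t1 p) - (w t2 \<rho> - w t1 \<rho>)
          - (\<tau> (Suc k) p - T) *\<^sub>R (phase_field (M k) (F k) T (w T \<rho>) \<rho>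
            - phase_field (M (Suc k)) (F (Suc k)) T (w T \<rho>) \<rho>)"
      have "snd ?X = (v t2 p - v t1 p) - (v t2 \<rho> - v t1 \<rho>) - (\<tau> (Suc k) p - T) *\<^sub>R jump"
        using elim(1,2) t by (simp add: w_snd w_T phase_field_def jump_def flip: T_def)
      moreover have "norm (snd ?X) \<le> norm ?X"
        by (metis norm_snd_le surjective_pairing)
      ultimately show ?case
        using elim(3) by simp
    qed
  qed
  with d show thesis
    by (rule that)
qed

text \<open>The acceleration equals the right-hand side along the trajectory on each side, and that
  right-hand side is continuous at the event state, being locally Lipschitz.\<close>

lemma acceleration_tendsto:
  assumes k: "k < N" and \<rho>: "\<rho> \<in> P"
    and v_eve: "((\<lambda>t. v t \<rho>) \<longlongrightarrow> v_eve) (at (\<tau> (Suc k) \<rho>))"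
  defines "T \<equiv> \<tau> (Suc k) \<rho>"
  shows "(acceleration q \<rho> \<longlongrightarrow> eom (M k) (F k) T (q T \<rho>) v_eve \<rho>) (at_left T)"
    and "(acceleration q \<rho> \<longlongrightarrow> eom (M (Suc k)) (F (Suc k)) T (q T \<rho>) v_eve \<rho>) (at_right T)"
proof -
  have between: "\<tau> k \<rho> < T" "T < \<tau> (Suc (Suc k)) \<rho>"
    using times_increasing[of k \<rho>] times_increasing[of "Suc k" \<rho>] k \<rho> unfolding T_def by auto
  have T: "T \<in> {t0<..<tF}"
    using between times_bounds[of k \<rho>] times_bounds[of "Suc (Suc k)" \<rho>] k \<rho> by auto
  have q_T: "((\<lambda>t. q t \<rho>) \<longlongrightarrow> q T \<rho>) (at T)"
    using position_isCont[OF k \<rho> between] by (simp add: isCont_def)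
  \<comment> \<open>Either phase's right-hand side is defined across the event, so its limit along
    the trajectory is two-sided; the sides part only in which phase yields the acceleration.\<close>
  have eom_T: "((\<lambda>t. eom (M j) (F j) t (q t \<rho>) (v t \<rho>) \<rho>) \<longlongrightarrow> eom (M j) (F j) T (q T \<rho>) v_eve \<rho>) (at T)"
    if j: "j \<le> N" for j
  proof -
    obtain e L where e: "e > 0" and L: "L-lipschitz_on (cball (T, (q T \<rho>, v_eve), \<rho>) e)
        (\<lambda>(t, x, \<rho>). phase_field (M j) (F j) t x \<rho>)"
      using phase_field_locally_lipschitz[OF regular[OF j] open_greaterThanLessThan open_parameters T \<rho>]
      by metis
    have "isCont (\<lambda>(t, x, \<rho>). phase_field (M j) (F j) t x \<rho>) (T, (q T \<rho>, v_eve), \<rho>)"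
      by (rule continuous_on_interior[OF lipschitz_on_continuous_on[OF L]])
        (use e in \<open>simp add: interior_cball\<close>)
    moreover have "((\<lambda>t. (t, (q t \<rho>, v t \<rho>), \<rho>)) \<longlongrightarrow> (T, (q T \<rho>, v_eve), \<rho>)) (at T)"
      using q_T v_eve unfolding T_def by (intro tendsto_intros)
    ultimately have "((\<lambda>t. case (t, (q t \<rho>, v t \<rho>), \<rho>) of (t, x, \<rho>) \<Rightarrow> phase_field (M j) (F j) t x \<rho>)
        \<longlongrightarrow> (case (T, (q T \<rho>, v_eve), \<rho>) of (t, x, \<rho>) \<Rightarrow> phase_field (M j) (F j) t x \<rho>)) (at T)"
      by (rule isCont_tendsto_compose)
    then show ?thesis
      by (auto simp: phase_field_def dest: tendsto_snd)
  qed
  have "\<forall>\<^sub>F t in at_left T. t \<in> {\<tau> k \<rho><..<T}"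
    using between by (intro eventually_at_leftI) auto
  then have "\<forall>\<^sub>F t in at_left T. eom (M k) (F k) t (q t \<rho>) (v t \<rho>) \<rho> = acceleration q \<rho> t"
    by eventually_elim (use k \<rho> in \<open>auto simp: acceleration_eq[of k] T_def\<close>)
  moreover have "((\<lambda>t. eom (M k) (F k) t (q t \<rho>) (v t \<rho>) \<rho>) \<longlongrightarrow> eom (M k) (F k) T (q T \<rho>) v_eve \<rho>) (at_left T)"
    by (rule tendsto_within_subset[OF eom_T]) (use k in auto)
  ultimately show "(acceleration q \<rho> \<longlongrightarrow> eom (M k) (F k) T (q T \<rho>) v_eve \<rho>) (at_left T)"
    by (rule Lim_transform_eventually[rotated])
  have "\<forall>\<^sub>F t in at_right T. t \<in> {T<..<\<tau> (Suc (Suc k)) \<rho>}"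
    using between by (intro eventually_at_rightI) auto
  then have "\<forall>\<^sub>F t in at_right T. eom (M (Suc k)) (F (Suc k)) t (q t \<rho>) (v t \<rho>) \<rho> = acceleration q \<rho> t"
    by eventually_elim (use k \<rho> in \<open>auto simp: acceleration_eq[of "Suc k"] T_def\<close>)
  moreover have "((\<lambda>t. eom (M (Suc k)) (F (Suc k)) t (q t \<rho>) (v t \<rho>) \<rho>) \<longlongrightarrow>
      eom (M (Suc k)) (F (Suc k)) T (q T \<rho>) v_eve \<rho>) (at_right T)"
    by (rule tendsto_within_subset[OF eom_T]) (use k in auto)
  ultimately show "(acceleration q \<rho> \<longlongrightarrow> eom (M (Suc k)) (F (Suc k)) T (q T \<rho>) v_eve \<rho>) (at_right T)"
    by (rule Lim_transform_eventually[rotated])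
qed

end

section \<open>From the estimate to the sensitivity matrices\<close>

text \<open>A column times a row is a rank-one matrix. The embedding \<open>vec\<close> of the reals
  into \<open>real^1\<close> carries the derivative of \<open>\<tau>\<close> to the row
  \<open>time_sensitivity\<close>.\<close>

lemma columnvector_time_sensitivity_mult:
  fixes \<tau> :: "real^'p::finite \<Rightarrow> real" and a :: "real^'n::finite"
  assumes "(\<tau> has_derivative \<tau>') (at \<rho>)"
  shows "(columnvector a ** time_sensitivity \<tau> \<rho>) *v h = \<tau>' h *\<^sub>R a"
proof -
  have "((\<lambda>\<rho>. vec (\<tau> \<rho>) :: real^1) has_derivative (\<lambda>h. vec (\<tau>' h))) (at \<rho>)"
    by (subst has_derivative_componentwise_within) (simp add: Basis_vec_def inner_axis assms)
  then have "frechet_derivative (\<lambda>\<rho>. vec (\<tau> \<rho>) :: real^1) (at \<rho>) = (\<lambda>h. vec (\<tau>' h))"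
    and "linear (\<lambda>h. vec (\<tau>' h) :: real^1)"
    by (simp_all add: frechet_derivative_at[symmetric] has_derivative_linear)
  then have "time_sensitivity \<tau> \<rho> *v h = vec (\<tau>' h)"
    unfolding time_sensitivity_def jacobian_def by (simp add: matrix_works)
  then have "(columnvector a ** time_sensitivity \<tau> \<rho>) *v h = columnvector a *v (vec (\<tau>' h) :: real^1)"
    by (simp flip: matrix_vector_mul_assoc)
  also have "\<dots> = \<tau>' h *\<^sub>R a"
    by (simp add: vec_eq_iff matrix_vector_mult_def columnvector_def)
  finally show ?thesis .
qed

lemma matrix_vector_mult_tendsto:
  fixes A :: "'a \<Rightarrow> real^'m^'n"
  shows "(A \<longlongrightarrow> B) net \<Longrightarrow> ((\<lambda>t. A t *v h) \<longlongrightarrow> B *v h) net"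
  using bounded_linear.tendsto[OF
      bounded_bilinear.bounded_linear_left[OF bounded_bilinear_matrix_vector_mult]] .

text \<open>With \<open>t1 = T - e\<close> and \<open>t2 = T + e\<close>, the derivative at
  \<open>\<rho>\<close> of \<open>v t2 p - v t1 p\<close> minus \<open>\<tau> p\<close> times
  \<open>jump\<close> is at most \<open>C * (2 * e) * norm h\<close> in direction \<open>h\<close>.
  Letting \<open>e\<close> tend to \<open>0\<close> leaves the jump relation.\<close>

lemma sensitivity_jump:
  fixes v :: "real \<Rightarrow> real^'p::finite \<Rightarrow> real^'n::finite"
  assumes \<tau>: "(\<tau> has_derivative \<tau>') (at \<rho>)"
    and diff: "\<forall>\<^sub>F t in at T. v t differentiable (at \<rho>)"
    and V: "(velocity_sensitivity v \<rho> \<longlongrightarrow> V_minus) (at_left T)"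
      "(velocity_sensitivity v \<rho> \<longlongrightarrow> V_plus) (at_right T)"
    and d: "d > 0"
    and estimate: "\<And>t1 t2. T - d < t1 \<Longrightarrow> t1 < T \<Longrightarrow> T < t2 \<Longrightarrow> t2 < T + d \<Longrightarrow>
      \<forall>\<^sub>F p in nhds \<rho>. norm ((v t2 p - v t1 p) - (v t2 \<rho> - v t1 \<rho>) - (\<tau> p - \<tau> \<rho>) *\<^sub>R jump)
        \<le> C * (t2 - t1) * norm (p - \<rho>)"
  shows "V_plus *v h = V_minus *v h + \<tau>' h *\<^sub>R jump"
proof -
  have right: "filterlim (\<lambda>e. T + e) (at_right T) (at_right 0)"
    by (rule filterlim_at_withinI) (auto intro!: tendsto_eq_intros simp: eventually_at_filter)
  have left: "filterlim (\<lambda>e. T - e) (at_left T) (at_right 0)"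
    by (rule filterlim_at_withinI) (auto intro!: tendsto_eq_intros simp: eventually_at_filter)
  let ?V = "\<lambda>t. velocity_sensitivity v \<rho> t"
  let ?D = "\<lambda>e. ?V (T + e) *v h - ?V (T - e) *v h - \<tau>' h *\<^sub>R jump"
  have lim: "((\<lambda>e. norm (?D e)) \<longlongrightarrow> norm (V_plus *v h - V_minus *v h - \<tau>' h *\<^sub>R jump)) (at_right 0)"
    by (intro tendsto_intros matrix_vector_mult_tendsto filterlim_compose[OF V(1) left]
        filterlim_compose[OF V(2) right])
  have lim0: "((\<lambda>e. C * (2 * e) * norm h) \<longlongrightarrow> 0) (at_right 0)"
    by (auto intro!: tendsto_eq_intros)
  have diff': "\<forall>\<^sub>F t in at_left T. v t differentiable (at \<rho>)" "\<forall>\<^sub>F t in at_right T. v t differentiable (at \<rho>)"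
    using diff by (simp_all add: eventually_at_split)
  have "\<forall>\<^sub>F e in at_right 0. 0 < e \<and> e < d"
    using d by (intro eventually_at_rightI[of 0 d]) auto
  with eventually_compose_filterlim[OF diff'(1) left] eventually_compose_filterlim[OF diff'(2) right]
  have "\<forall>\<^sub>F e in at_right 0. norm (?D e) \<le> C * (2 * e) * norm h"
  proof eventually_elim
    case (elim e)
    let ?f = "\<lambda>p. v (T + e) p - v (T - e) p - \<tau> p *\<^sub>R jump"
    have "(v t has_derivative (\<lambda>h. ?V t *v h)) (at \<rho>)" if "v t differentiable (at \<rho>)" for t
      using that unfolding velocity_sensitivity_def by (simp add: jacobian_works)
    then have "(?f has_derivative (\<lambda>h. ?V (T + e) *v h - ?V (T - e) *v h - \<tau>' h *\<^sub>R jump)) (at \<rho>)"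
      using elim \<tau> by (intro derivative_intros) auto
    moreover have "\<forall>\<^sub>F p in nhds \<rho>. norm (?f p - ?f \<rho>) \<le> C * (2 * e) * norm (p - \<rho>)"
      using estimate[of "T - e" "T + e"] elim(3) by (simp add: algebra_simps)
    then have "\<forall>\<^sub>F p in at \<rho>. norm (?f p - ?f \<rho>) \<le> C * (2 * e) * norm (p - \<rho>)"
      by (simp add: eventually_nhds_conv_at)
    ultimately show ?case
      by (rule has_derivative_norm_le)
  qed
  then have "norm (V_plus *v h - V_minus *v h - \<tau>' h *\<^sub>R jump) \<le> 0"
    by (rule tendsto_le[OF trivial_limit_at_right_real lim0 lim])
  then show ?thesis
    by (simp add: algebra_simps)
qed

theorem theorem4:
  fixes t0 tF :: real
    and P :: "(real^'p::finite) set"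
    and N k :: nat
    and M :: "nat \<Rightarrow> ('n::finite, 'p) mass"
    and F :: "nat \<Rightarrow> ('n, 'p) force"
    and q0 v0 :: "real^'p \<Rightarrow> real^'n"
    and \<tau> :: "nat \<Rightarrow> real^'p \<Rightarrow> real"
    and q v :: "real \<Rightarrow> real^'p \<Rightarrow> real^'n"
    and r :: "real^'n \<Rightarrow> real"
    and \<rho> :: "real^'p"
    and t_eve :: "real^'p \<Rightarrow> real"
    and f_minus f_plus :: "('n, 'p) force"
    and q_eve v_eve acc_minus acc_plus :: "real^'n"
    and V_minus V_plus :: "real^'p^'n"
  assumes system: "hybrid_system t0 tF P N M F q0 v0 \<tau> q v"
    and parameter: "\<rho> \<in> P"
    and event: "k < N" "t_eve = \<tau> (Suc k)"
    and eom_change: "f_minus = eom (M k) (F k)" "f_plus = eom (M (Suc k)) (F (Suc k))"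
    and event_function: "smooth_on r UNIV"
      "\<And>\<rho>'. \<rho>' \<in> P \<Longrightarrow> r (q (t_eve \<rho>') \<rho>') = 0"
    and no_velocity_jump: "\<And>\<rho>'. \<rho>' \<in> P \<Longrightarrow>
          \<exists>l. ((\<lambda>t. v t \<rho>') \<longlongrightarrow> l) (at_left (t_eve \<rho>')) \<and>
              ((\<lambda>t. v t \<rho>') \<longlongrightarrow> l) (at_right (t_eve \<rho>'))"
    and position_at_event: "q_eve = q (t_eve \<rho>) \<rho>"
    and velocity_at_event: "((\<lambda>t. v t \<rho>) \<longlongrightarrow> v_eve) (at (t_eve \<rho>))"
    and no_grazing: "frechet_derivative r (at q_eve) v_eve \<noteq> 0"
    and event_time_differentiable: "t_eve differentiable (at \<rho>)"
    and velocity_differentiable: "\<forall>\<^sub>F t in at (t_eve \<rho>). v t differentiable (at \<rho>)"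
    and position_differentiable: "\<forall>\<^sub>F t in at_left (t_eve \<rho>). q t differentiable (at \<rho>)"
    and acceleration_limits:
      "(acceleration q \<rho> \<longlongrightarrow> acc_minus) (at_left (t_eve \<rho>))"
      "(acceleration q \<rho> \<longlongrightarrow> acc_plus) (at_right (t_eve \<rho>))"
    and sensitivity_limits:
      "(velocity_sensitivity v \<rho> \<longlongrightarrow> V_minus) (at_left (t_eve \<rho>))"
      "(velocity_sensitivity v \<rho> \<longlongrightarrow> V_plus) (at_right (t_eve \<rho>))"
  shows "V_plus = V_minus -
             columnvector (acc_plus - acc_minus) ** time_sensitivity t_eve \<rho> \<and>
         V_minus - columnvector (acc_plus - acc_minus) ** time_sensitivity t_eve \<rho> =
           V_minus -
             columnvector (f_plus (t_eve \<rho>) q_eve v_eve \<rho> - f_minus (t_eve \<rho>) q_eve v_eve \<rho>)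
               ** time_sensitivity t_eve \<rho>"
proof -
  interpret hybrid_system t0 tF P N M F q0 v0 \<tau> q v
    by (rule system)
  let ?T = "t_eve \<rho>"
  \<comment> \<open>Uniqueness of one-sided limits identifies the accelerations with the values of
    the two right-hand sides; this is the second equality of the claim.\<close>
  have left: "f_minus ?T q_eve v_eve \<rho> = acc_minus" and right: "f_plus ?T q_eve v_eve \<rho> = acc_plus"
    using acceleration_tendsto[OF event(1) parameter, of v_eve] velocity_at_event acceleration_limits
    unfolding event(2) eom_change position_at_event
    by (auto intro: tendsto_unique[rotated] simp: trivial_limit_at_left_real trivial_limit_at_right_real)
  obtain \<tau>' where \<tau>': "(t_eve has_derivative \<tau>') (at \<rho>)"
    using event_time_differentiable unfolding differentiable_def by blast
  have v_diff: "\<forall>\<^sub>F t in at_left ?T. v t differentiable (at \<rho>)"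
    using velocity_differentiable by (simp add: eventually_at_split)
  obtain C d where d: "d > 0" and estimate:
    "\<And>t1 t2. ?T - d < t1 \<Longrightarrow> t1 < ?T \<Longrightarrow> ?T < t2 \<Longrightarrow> t2 < ?T + d \<Longrightarrow>
      \<forall>\<^sub>F p in nhds \<rho>. norm ((v t2 p - v t1 p) - (v t2 \<rho> - v t1 \<rho>) - (t_eve p - t_eve \<rho>) *\<^sub>R
          (f_minus ?T q_eve v_eve \<rho> - f_plus ?T q_eve v_eve \<rho>)) \<le> C * (t2 - t1) * norm (p - \<rho>)"
    unfolding event(2) eom_change position_at_event
    by (rule eom_change_estimate[OF event(1) parameter,
          OF no_velocity_jump[unfolded event(2)] velocity_at_event[unfolded event(2)]
            event_time_differentiable[unfolded event(2)] v_diff[unfolded event(2)]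
            position_differentiable[unfolded event(2)]], assumption) (rule that[unfolded event(2) eom_change position_at_event])
  \<comment> \<open>The jump in the estimate is \<open>acc_minus - acc_plus\<close>, which accounts
    for the minus sign. The matrices agree because they agree on every \<open>h\<close>.\<close>
  have "V_plus *v h = (V_minus - columnvector (acc_plus - acc_minus) ** time_sensitivity t_eve \<rho>) *v h" for h
    using sensitivity_jump[OF \<tau>' velocity_differentiable sensitivity_limits d estimate, of h]
    unfolding left right
    by (simp add: columnvector_time_sensitivity_mult[OF \<tau>'] algebra_simps)
  then have "V_plus = V_minus - columnvector (acc_plus - acc_minus) ** time_sensitivity t_eve \<rho>"
    by (simp add: matrix_eq)
  then show ?thesis
    unfolding left right by simp
qed

end
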